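(* Let $G=(V,E)$ be a graph, let $\omega:E\to\mathbb{Q}$ be an edge-weight function, let $\chi$ be a $c$-coloring of $G$, and let $S\subseteq V$ be a set of size at most $k$. One can compute in $O(3^k\cdot c\cdot k^2+k\cdot\Delta(G))$ time a $c$-coloring $\chi'$ of $G$ such that $D_{\mathrm{flip}}(\chi,\chi')\subseteq S$ and $\omega(E(\chi'))$ is maximal among all $c$-colorings with this property.
   Context: A $c$-coloring is a function $V\to\{1,\dots,c\}$. $D_{\mathrm{flip}}(\chi,\chi')=\{v\in V:\chi(v)\neq\chi'(v)\}$. $E(\chi)=\{\{u,v\}\in E:\chi(u)\neq\chi(v)\}$ and $\omega(F)$ is the total weight of an edge set $F$. $\Delta(G)$ is the maximum degree of $G$. *)

theory Defs
  imports Complex_Main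
begin

section \<open>Graphs and colorings\<close>

definition graph :: "'v set \<Rightarrow> 'v set set \<Rightarrow> bool" where
  "graph V E \<longleftrightarrow> finite V \<and> (\<forall>e\<in>E. e \<subseteq> V \<and> card e = 2)"

definition neighbours :: "'v set set \<Rightarrow> 'v \<Rightarrow> 'v set" where
  "neighbours E v = {u. {u, v} \<in> E}"

definition degree :: "'v set set \<Rightarrow> 'v \<Rightarrow> nat" where
  "degree E v = card (neighbours E v)"

text \<open>The inserted \<open>0\<close> only matters for the graph without vertices.\<close>

definition max_degree :: "'v set \<Rightarrow> 'v set set \<Rightarrow> nat" where
  "max_degree V E = Max (insert 0 (degree E ` V))"

text \<open>Only the values of \<open>\<chi>\<close> on \<open>V\<close> are relevant here and below.\<close>

definition coloring :: "'v set \<Rightarrow> nat \<Rightarrow> ('v \<Rightarrow> nat) \<Rightarrow> bool" where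
  "coloring V c \<chi> \<longleftrightarrow> (\<forall>v\<in>V. \<chi> v \<in> {1..c})"

definition D_flip :: "'v set \<Rightarrow> ('v \<Rightarrow> nat) \<Rightarrow> ('v \<Rightarrow> nat) \<Rightarrow> 'v set" where
  "D_flip V \<chi> \<chi>' = {v \<in> V. \<chi> v \<noteq> \<chi>' v}"

definition cut_edges :: "'v set set \<Rightarrow> ('v \<Rightarrow> nat) \<Rightarrow> 'v set set" where
  "cut_edges E \<chi> = {e \<in> E. \<exists>u v. e = {u, v} \<and> \<chi> u \<noteq> \<chi> v}"

definition weight :: "('v set \<Rightarrow> rat) \<Rightarrow> 'v set set \<Rightarrow> rat" where
  "weight \<omega> F = (\<Sum>e\<in>F. \<omega> e)"

section \<open>A random access machine\<close>

text \<open>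
  Programs are while-programs over finitely many named, unbounded arrays that hold natural
  numbers or rational numbers; a scalar is the cell of an array at a constant index.
  The only arithmetic operations are addition and (on natural numbers, truncated) subtraction.
  Multiplication is left out on purpose: as a unit-cost operation it would allow repeated
  squaring. There is no conversion between the two sorts of numbers.
\<close>

type_synonym vname = string

datatype nexp =
    NConst nat
  | NRead vname nexp
  | NPlus nexp nexp
  | NMinus nexp nexp

datatype rexp =
    RConst rat
  | RRead vname nexp
  | RPlus rexp rexp
  | RMinus rexp rexp

datatype bexp =
    NLess nexp nexp
  | RLess rexp rexp
  | BNot bexp
  | BAnd bexp bexp

datatype com =
    Skip
  | NWrite vname nexp nexp
  | RWrite vname nexp rexp
  | Seq com com
  | If bexp com com
  | While bexp com

record state =
  nmem :: "vname \<Rightarrow> nat \<Rightarrow> nat"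
  rmem :: "vname \<Rightarrow> nat \<Rightarrow> rat"

fun nval :: "nexp \<Rightarrow> state \<Rightarrow> nat" where
  "nval (NConst n) s = n"
| "nval (NRead x e) s = nmem s x (nval e s)"
| "nval (NPlus e f) s = nval e s + nval f s"
| "nval (NMinus e f) s = nval e s - nval f s"

fun rval :: "rexp \<Rightarrow> state \<Rightarrow> rat" where
  "rval (RConst q) s = q"
| "rval (RRead x e) s = rmem s x (nval e s)"
| "rval (RPlus e f) s = rval e s + rval f s"
| "rval (RMinus e f) s = rval e s - rval f s"

fun bval :: "bexp \<Rightarrow> state \<Rightarrow> bool" where
  "bval (NLess e f) s \<longleftrightarrow> nval e s < nval f s"
| "bval (RLess e f) s \<longleftrightarrow> rval e s < rval f s"
| "bval (BNot b) s \<longleftrightarrow> \<not> bval b s"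
| "bval (BAnd b b') s \<longleftrightarrow> bval b s \<and> bval b' s"

definition nwrite :: "vname \<Rightarrow> nat \<Rightarrow> nat \<Rightarrow> state \<Rightarrow> state" where
  "nwrite x i n s = s\<lparr>nmem := (nmem s)(x := (nmem s x)(i := n))\<rparr>"

definition rwrite :: "vname \<Rightarrow> nat \<Rightarrow> rat \<Rightarrow> state \<Rightarrow> state" where
  "rwrite x i q s = s\<lparr>rmem := (rmem s)(x := (rmem s x)(i := q))\<rparr>"

text \<open>
  \<open>exec P s t s'\<close>: started in \<open>s\<close>, the program \<open>P\<close> halts in \<open>s'\<close> after \<open>t\<close> steps.
  Each executed assignment and each evaluated test costs one step. The expressions of a program
  have constant size, so charging for every operation in them would change the
  running time of a program by a constant factor only.
\<close>

inductive exec :: "com \<Rightarrow> state \<Rightarrow> nat \<Rightarrow> state \<Rightarrow> bool" where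
  Skip: "exec Skip s 1 s"
| NWrite: "exec (NWrite x e f) s 1 (nwrite x (nval e s) (nval f s) s)"
| RWrite: "exec (RWrite x e f) s 1 (rwrite x (nval e s) (rval f s) s)"
| Seq: "exec P s t s' \<Longrightarrow> exec Q s' t' s'' \<Longrightarrow> exec (Seq P Q) s (t + t') s''"
| IfTrue: "bval b s \<Longrightarrow> exec P s t s' \<Longrightarrow> exec (If b P Q) s (1 + t) s'"
| IfFalse: "\<not> bval b s \<Longrightarrow> exec Q s t s' \<Longrightarrow> exec (If b P Q) s (1 + t) s'"
| WhileFalse: "\<not> bval b s \<Longrightarrow> exec (While b P) s 1 s"
| WhileTrue: "bval b s \<Longrightarrow> exec P s t s' \<Longrightarrow> exec (While b P) s' t' s'' \<Longrightarrow>
    exec (While b P) s (1 + t + t') s''"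

lemma exec_deterministic:
  "exec P s t s' \<Longrightarrow> exec P s u r \<Longrightarrow> u = t \<and> r = s'"
proof (induction arbitrary: u r rule: exec.induct)
  case (Seq P s t s' Q t' s'')
  from Seq.prems show ?case
    by cases (use Seq.IH in metis)
next
  case (IfTrue b s P t s' Q)
  from IfTrue.prems show ?case
    by cases (use IfTrue.hyps(1) IfTrue.IH in metis)+
next
  case (IfFalse b s Q t s' P)
  from IfFalse.prems show ?case
    by cases (use IfFalse.hyps(1) IfFalse.IH in metis)+
next
  case (WhileFalse b s P)
  from WhileFalse.prems show ?case
    by cases (use WhileFalse.hyps(1) in simp_all)
next
  case (WhileTrue b s P t s' t' s'')
  from WhileTrue.prems show ?case
    by cases (use WhileTrue.hyps(1) WhileTrue.IH in metis)+
qed (auto elim: exec.cases)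

section \<open>Encoding of instances\<close>

text \<open>
  Vertices are natural numbers, so that they can be used as array indices.
  The neighbours of \<open>v\<close> and the weights of the corresponding edges are listed, in any order,
  in the arrays \<open>adj\<close> and \<open>wt\<close> at the addresses \<open>start v, \<dots>, start v + deg v - 1\<close>.
  All arrays that do not belong to the input are initially zero.
  Since the running time does not depend on \<open>card V\<close>, the new coloring has to be left in
  the array \<open>col\<close> that holds the given coloring initially.
\<close>

definition input_arrays :: "vname set" where
  "input_arrays = {''n'', ''V'', ''deg'', ''start'', ''adj'', ''c'', ''col'', ''size'', ''S''}"

definition encodes ::
  "state \<Rightarrow> nat set \<Rightarrow> nat set set \<Rightarrow> (nat set \<Rightarrow> rat) \<Rightarrow> nat \<Rightarrow> (nat \<Rightarrow> nat) \<Rightarrow> nat set \<Rightarrow> bool" where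
  "encodes s V E \<omega> c \<chi> S \<longleftrightarrow>
    nmem s ''n'' 0 = card V \<and>
    bij_betw (nmem s ''V'') {..<card V} V \<and>
    (\<forall>v\<in>V.
      nmem s ''deg'' v = degree E v \<and>
      bij_betw (\<lambda>p. nmem s ''adj'' (nmem s ''start'' v + p)) {..<degree E v} (neighbours E v) \<and>
      (\<forall>p<degree E v. rmem s ''wt'' (nmem s ''start'' v + p) =
        \<omega> {v, nmem s ''adj'' (nmem s ''start'' v + p)})) \<and>
    nmem s ''c'' 0 = c \<and>
    (\<forall>v\<in>V. nmem s ''col'' v = \<chi> v) \<and>
    nmem s ''size'' 0 = card S \<and>
    bij_betw (nmem s ''S'') {..<card S} S \<and>
    (\<forall>x. x \<notin> input_arrays \<longrightarrow> nmem s x = (\<lambda>_. 0)) \<and>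
    (\<forall>x. x \<noteq> ''wt'' \<longrightarrow> rmem s x = (\<lambda>_. 0))"

definition output_coloring :: "state \<Rightarrow> nat \<Rightarrow> nat" where
  "output_coloring s = nmem s ''col''"

end

theory Submission
  imports Defs "HOL-Library.Nat_Bijection"
begin

text \<open>
  Maximizing the weight of the cut is minimizing the weight of the monochromatic edges that meet
  \<open>S\<close>. Charging such an edge to its endpoint in \<open>S\<close> of larger index splits this weight as a sum
  over the colors, in which the vertices of \<open>S\<close> of one color, \<open>B\<close>, contribute a cost that does not
  depend on the other classes. The minimum over all ordered partitions of \<open>S\<close> is found color by
  color, \<open>min_cost g (n + 1) X\<close> being the minimum of \<open>min_cost g n (X - B) + g (n + 1) B\<close> over
  all \<open>B \<subseteq> X\<close>. So each color costs one step for every pair of disjoint subsets of \<open>S\<close>, that is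
  \<open>3 ^ card S\<close> steps.

  The machine has neither multiplication nor bit operations. Subsets of \<open>S\<close> are therefore stored as
  sums of powers of two, and everything that is indexed by subsets (the list of disjoint pairs, the
  costs) is built by adding one vertex at a time and copying what is there already.
\<close>

section \<open>The weight of a cut in terms of color classes\<close>

definition mono_edges :: "'v set set \<Rightarrow> ('v \<Rightarrow> nat) \<Rightarrow> 'v set set" where
  "mono_edges E \<chi> = E - cut_edges E \<chi>"

definition edges_avoiding :: "'v set set \<Rightarrow> 'v set \<Rightarrow> 'v set set" where
  "edges_avoiding E T = {e \<in> E. e \<inter> T = {}}"

lemma finite_edges: "graph V E \<Longrightarrow> finite E"
  unfolding graph_def by (meson Pow_iff finite_Pow_iff finite_subset subsetI)

lemma neighbours_subset: "graph V E \<Longrightarrow> neighbours E v \<subseteq> V - {v}"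
  by (auto simp: graph_def neighbours_def)

lemma finite_neighbours: "graph V E \<Longrightarrow> finite (neighbours E v)"
  by (meson finite_Diff finite_subset graph_def neighbours_subset)

lemma degree_le_max_degree: "finite V \<Longrightarrow> v \<in> V \<Longrightarrow> degree E v \<le> max_degree V E"
  unfolding max_degree_def by (intro Max_ge) auto

lemma graph_mono_edges: "graph V E \<Longrightarrow> graph V (mono_edges E \<chi>)"
  by (simp add: graph_def mono_edges_def)

lemma neighbours_mono_edges:
  "neighbours (mono_edges E \<chi>) v = {u \<in> neighbours E v. \<chi> u = \<chi> v}"
  by (auto simp: neighbours_def mono_edges_def cut_edges_def doubleton_eq_iff)

lemma weight_cut_edges_eq:
  assumes "finite E"
  shows "weight \<omega> (cut_edges E \<chi>) = weight \<omega> E - weight \<omega> (mono_edges E \<chi>)"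
proof -
  have "cut_edges E \<chi> \<subseteq> E"
    by (auto simp: cut_edges_def)
  then show ?thesis
    using sum_diff[OF assms, of _ \<omega>] by (simp add: weight_def mono_edges_def)
qed

lemma cut_edges_cong:
  assumes "\<And>u. u \<in> \<Union>E \<Longrightarrow> \<chi>' u = \<chi> u"
  shows "cut_edges E \<chi>' = cut_edges E \<chi>"
proof -
  have "\<chi>' u = \<chi> u \<and> \<chi>' v = \<chi> v" if "{u, v} \<in> E" for u v
    using that assms by blast
  then show ?thesis
    unfolding cut_edges_def by (metis (no_types, lifting))
qed

lemma edges_avoiding_mono_edges_cong:
  assumes graph: "graph V E" and same: "\<And>u. u \<in> V - T \<Longrightarrow> \<chi>' u = \<chi> u"
  shows "edges_avoiding (mono_edges E \<chi>') T = edges_avoiding (mono_edges E \<chi>) T"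
proof -
  have avoid: "edges_avoiding (mono_edges E \<chi>) T =
      edges_avoiding E T - cut_edges (edges_avoiding E T) \<chi>" for \<chi>
    by (auto simp: edges_avoiding_def mono_edges_def cut_edges_def)
  have "\<Union>(edges_avoiding E T) \<subseteq> V - T"
    using graph by (auto simp: edges_avoiding_def graph_def)
  then have "cut_edges (edges_avoiding E T) \<chi>' = cut_edges (edges_avoiding E T) \<chi>"
    using same by (intro cut_edges_cong) blast
  then show ?thesis
    unfolding avoid by simp
qed

lemma weight_edges_avoiding_insert:
  assumes graph: "graph V E" and "v \<notin> T"
  shows "weight \<omega> (edges_avoiding E T) =
    weight \<omega> (edges_avoiding E (insert v T)) + (\<Sum>u\<in>neighbours E v - T. \<omega> {v, u})"
proof -
  let ?N = "neighbours E v - T"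
  have "edges_avoiding E T = edges_avoiding E (insert v T) \<union> (\<lambda>u. {v, u}) ` ?N"
  proof
    show "edges_avoiding E T \<subseteq> edges_avoiding E (insert v T) \<union> (\<lambda>u. {v, u}) ` ?N"
    proof
      fix e assume e: "e \<in> edges_avoiding E T"
      show "e \<in> edges_avoiding E (insert v T) \<union> (\<lambda>u. {v, u}) ` ?N"
      proof (cases "v \<in> e")
        case True
        moreover have "card e = 2"
          using e graph by (simp add: edges_avoiding_def graph_def)
        ultimately obtain u where "e = {v, u}"
          by (auto simp: card_2_iff)
        then show ?thesis
          using e by (auto simp: edges_avoiding_def neighbours_def insert_commute)
      qed (use e in \<open>simp add: edges_avoiding_def\<close>)
    qed
  qed (use \<open>v \<notin> T\<close> in \<open>auto simp: edges_avoiding_def neighbours_def insert_commute\<close>)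
  moreover have "finite (edges_avoiding E (insert v T))"
    using finite_edges[OF graph] by (simp add: edges_avoiding_def)
  moreover have "edges_avoiding E (insert v T) \<inter> (\<lambda>u. {v, u}) ` ?N = {}"
    by (auto simp: edges_avoiding_def)
  ultimately have "weight \<omega> (edges_avoiding E T) =
      weight \<omega> (edges_avoiding E (insert v T)) + (\<Sum>e\<in>(\<lambda>u. {v, u}) ` ?N. \<omega> e)"
    using finite_neighbours[OF graph] by (simp add: weight_def sum.union_disjoint)
  also have "(\<Sum>e\<in>(\<lambda>u. {v, u}) ` ?N. \<omega> e) = (\<Sum>u\<in>?N. \<omega> {v, u})"
    by (rule sum.reindex_cong) (auto simp: inj_on_def doubleton_eq_iff)
  finally show ?thesis .
qed

lemma weight_charged_to_last_endpoint:
  fixes sv :: "nat \<Rightarrow> 'v"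
  assumes graph: "graph V E" and inj: "inj_on sv {..<m}"
  shows "weight \<omega> E = weight \<omega> (edges_avoiding E (sv ` {..<m})) +
    (\<Sum>j<m. \<Sum>u\<in>neighbours E (sv j) - sv ` {j<..<m}. \<omega> {sv j, u})"
proof -
  let ?charge = "\<lambda>j. \<Sum>u\<in>neighbours E (sv j) - sv ` {j<..<m}. \<omega> {sv j, u}"
  have "weight \<omega> (edges_avoiding E (sv ` {i..<m})) =
      weight \<omega> (edges_avoiding E (sv ` {..<m})) + (\<Sum>j<i. ?charge j)" if "i \<le> m" for i
    using that
  proof (induction i)
    case (Suc i)
    have "{i..<m} = insert i {i<..<m}" "{Suc i..<m} = {i<..<m}"
      using Suc.prems by auto
    moreover have "sv i \<notin> sv ` {i<..<m}"
      using Suc.prems by (auto simp: inj_on_eq_iff[OF inj])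
    ultimately have "weight \<omega> (edges_avoiding E (sv ` {Suc i..<m})) =
        weight \<omega> (edges_avoiding E (sv ` {i..<m})) + ?charge i"
      using weight_edges_avoiding_insert[OF graph, of "sv i" "sv ` {i<..<m}" \<omega>] by simp
    then show ?case
      using Suc.IH Suc.prems by simp
  qed (simp add: atLeast0LessThan)
  from this[of m] show ?thesis
    by (simp add: edges_avoiding_def)
qed

section \<open>Partitions of minimal cost\<close>

fun min_cost ::
  "(nat \<Rightarrow> 'a set \<Rightarrow> 'b::{linorder,ordered_comm_monoid_add}) \<Rightarrow> nat \<Rightarrow> 'a set \<Rightarrow> 'b" where
  "min_cost g 0 X = g 0 X"
| "min_cost g (Suc n) X = (MIN B\<in>Pow X. min_cost g n (X - B) + g (Suc n) B)"

definition partition_cost ::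
  "(nat \<Rightarrow> 'a set \<Rightarrow> 'b::comm_monoid_add) \<Rightarrow> nat \<Rightarrow> 'a set \<Rightarrow> ('a \<Rightarrow> nat) \<Rightarrow> 'b" where
  "partition_cost g n X f = (\<Sum>i\<le>n. g i {x \<in> X. f x = i})"

definition optimal_class ::
  "(nat \<Rightarrow> 'a set \<Rightarrow> 'b::{linorder,ordered_comm_monoid_add}) \<Rightarrow> nat \<Rightarrow> 'a set \<Rightarrow> 'a set \<Rightarrow> bool" where
  "optimal_class g n X B \<longleftrightarrow> B \<subseteq> X \<and> min_cost g (Suc n) X = min_cost g n (X - B) + g (Suc n) B"

definition optimal_partition ::
  "(nat \<Rightarrow> 'a set \<Rightarrow> 'b::{linorder,ordered_comm_monoid_add}) \<Rightarrow> nat \<Rightarrow> 'a set \<Rightarrow> ('a \<Rightarrow> nat) \<Rightarrow> bool" where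
  "optimal_partition g n X f \<longleftrightarrow> f ` X \<subseteq> {..n} \<and> partition_cost g n X f = min_cost g n X"

lemma partition_cost_Suc:
  "partition_cost g (Suc n) X f =
    partition_cost g n (X - {x \<in> X. f x = Suc n}) f + g (Suc n) {x \<in> X. f x = Suc n}"
proof -
  have "{x \<in> X - {x \<in> X. f x = Suc n}. f x = i} = {x \<in> X. f x = i}" if "i \<le> n" for i
    using that by auto
  then show ?thesis
    by (simp add: partition_cost_def)
qed

lemma partition_cost_cong:
  assumes "\<And>x. x \<in> X \<Longrightarrow> f x = f' x"
  shows "partition_cost g n X f = partition_cost g n X f'"
proof -
  have "{x \<in> X. f x = i} = {x \<in> X. f' x = i}" for i
    using assms by auto
  then show ?thesis
    by (simp add: partition_cost_def)
qed

lemma optimal_partition_cong: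
  assumes "X = X'" "\<And>x. x \<in> X' \<Longrightarrow> f x = f' x"
  shows "optimal_partition g n X f \<longleftrightarrow> optimal_partition g n X' f'"
proof -
  have "f ` X = f' ` X'" "partition_cost g n X f = partition_cost g n X' f'"
    using assms by (auto intro: image_cong partition_cost_cong)
  then show ?thesis
    using assms(1) by (simp add: optimal_partition_def)
qed

lemma min_cost_le_partition_cost:
  assumes "finite X" "f ` X \<subseteq> {..n}"
  shows "min_cost g n X \<le> partition_cost g n X f"
  using assms
proof (induction n arbitrary: X)
  case 0
  then have "{x \<in> X. f x = 0} = X"
    by auto
  then show ?case
    by (simp add: partition_cost_def)
next
  case (Suc n)
  let ?B = "{x \<in> X. f x = Suc n}"
  have "min_cost g (Suc n) X \<le> min_cost g n (X - ?B) + g (Suc n) ?B"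
    using Suc.prems(1) unfolding min_cost.simps by (intro Min_le) auto
  also have "min_cost g n (X - ?B) \<le> partition_cost g n (X - ?B) f"
    using Suc.prems by (intro Suc.IH) (auto simp: le_Suc_eq)
  then have "min_cost g n (X - ?B) + g (Suc n) ?B \<le> partition_cost g (Suc n) X f"
    unfolding partition_cost_Suc by (rule add_right_mono)
  finally show ?case .
qed

lemma optimal_partition_0: "optimal_partition g 0 X (\<lambda>_. 0)"
  by (auto simp: optimal_partition_def partition_cost_def)

lemma optimal_partition_Suc:
  assumes last: "optimal_class g n X B" and others: "optimal_partition g n (X - B) f"
  shows "optimal_partition g (Suc n) X (\<lambda>x. if x \<in> B then Suc n else f x)"
proof -
  let ?f = "\<lambda>x. if x \<in> B then Suc n else f x"
  have f_le: "f x \<le> n" if "x \<in> X - B" for x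
    using others that by (auto simp: optimal_partition_def)
  then have "{x \<in> X. ?f x = Suc n} = B"
    using last by (force simp: optimal_class_def)
  then have "partition_cost g (Suc n) X ?f = partition_cost g n (X - B) ?f + g (Suc n) B"
    unfolding partition_cost_Suc by simp
  also have "partition_cost g n (X - B) ?f = min_cost g n (X - B)"
    using others partition_cost_cong[of "X - B" ?f f g n] by (simp add: optimal_partition_def)
  finally show ?thesis
    using last f_le by (auto simp: optimal_partition_def optimal_class_def intro: le_SucI)
qed

section \<open>Recoloring a sequence of vertices\<close>

text \<open>
  Here \<open>w j q\<close> is the weight between the \<open>j\<close>-th recolored vertex and the vertices of color \<open>q\<close> that
  keep their color, and \<open>w j (c + 1 + l)\<close> the weight of the edge to the \<open>l\<close>-th recolored vertex.
\<close>

definition class_cost :: "(nat \<Rightarrow> nat \<Rightarrow> 'a::comm_monoid_add) \<Rightarrow> nat \<Rightarrow> nat \<Rightarrow> nat set \<Rightarrow> 'a" where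
  "class_cost w c q A = (\<Sum>j\<in>A. w j q + (\<Sum>l\<in>A \<inter> {..<j}. w j (c + 1 + l)))"

lemma class_cost_insert_greatest:
  assumes "A \<subseteq> {..<m}"
  shows "class_cost w c q (insert m A) = class_cost w c q A + (w m q + (\<Sum>l\<in>A. w m (c + 1 + l)))"
proof -
  have "finite A" "m \<notin> A"
    using assms finite_subset by auto
  moreover have "insert m A \<inter> {..<j} = A \<inter> {..<j}" if "j \<in> A" for j
    using assms that by auto
  moreover have "insert m A \<inter> {..<m} = A"
    using assms by auto
  ultimately show ?thesis
    by (simp add: class_cost_def add.commute)
qed

locale recoloring =
  fixes V :: "'v set" and E :: "'v set set" and \<omega> :: "'v set \<Rightarrow> rat" and c :: nat
    and \<chi> :: "'v \<Rightarrow> nat" and sv :: "nat \<Rightarrow> 'v" and m :: nat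
  assumes graph: "graph V E"
    and coloring: "coloring V c \<chi>"
    and inj_sv: "inj_on sv {..<m}"
    and sv_in_V: "sv ` {..<m} \<subseteq> V"
begin

text \<open>
  The private color \<open>c + 1 + j\<close> of the \<open>j\<close>-th vertex makes one look-up of the color of a neighbour
  tell to which entry of a row of \<open>incident_weight\<close> an edge contributes.
\<close>

definition mark :: "'v \<Rightarrow> nat" where
  "mark u = (if u \<in> sv ` {..<m} then c + 1 + the_inv_into {..<m} sv u else \<chi> u)"

definition incident_weight :: "nat \<Rightarrow> nat \<Rightarrow> rat" where
  "incident_weight j q = (\<Sum>u | u \<in> neighbours E (sv j) \<and> mark u = q. \<omega> {sv j, u})"

abbreviation color_cost :: "nat \<Rightarrow> nat set \<Rightarrow> rat" where
  "color_cost i \<equiv> class_cost incident_weight c (Suc i)"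

lemma mark_sv [simp]: "j < m \<Longrightarrow> mark (sv j) = c + 1 + j"
  by (simp add: mark_def the_inv_into_f_f[OF inj_sv])

lemma mark_outside [simp]: "u \<notin> sv ` {..<m} \<Longrightarrow> mark u = \<chi> u"
  by (simp add: mark_def)

lemma mark_less:
  assumes "u \<in> V"
  shows "mark u < c + m + 1"
proof (cases "u \<in> sv ` {..<m}")
  case False
  then show ?thesis
    using coloring assms by (auto simp: coloring_def)
qed auto

lemma charged_neighbour_iff_mark:
  assumes col: "coloring V c \<chi>'" and same: "\<And>u. u \<in> V - sv ` {..<m} \<Longrightarrow> \<chi>' u = \<chi> u"
    and "j < m" and neighbour: "u \<in> neighbours E (sv j)" and "q \<le> c"
  shows "\<chi>' u = q \<and> u \<notin> sv ` {j<..<m} \<longleftrightarrow>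
    mark u \<in> insert q ((\<lambda>l. c + 1 + l) ` {l. l < j \<and> \<chi>' (sv l) = q})"
proof (cases "u \<in> sv ` {..<m}")
  case True
  then obtain l where l: "l < m" "u = sv l"
    by auto
  moreover have "l \<noteq> j"
    using neighbours_subset[OF graph] neighbour l by auto
  moreover have "u \<in> sv ` {j<..<m} \<longleftrightarrow> j < l"
    using l \<open>j < m\<close> by (auto simp: inj_on_eq_iff[OF inj_sv])
  ultimately show ?thesis
    using \<open>q \<le> c\<close> by (auto simp: image_iff)
next
  case False
  moreover have "u \<in> V"
    using neighbours_subset[OF graph] neighbour by auto
  moreover from this have "\<chi>' u \<le> c"
    using col by (simp add: coloring_def)
  ultimately show ?thesis
    using same[of u] by auto
qed

lemma charge_eq_incident_weights:
  assumes col: "coloring V c \<chi>'" and same: "\<And>u. u \<in> V - sv ` {..<m} \<Longrightarrow> \<chi>' u = \<chi> u"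
    and "j < m"
  shows "(\<Sum>u\<in>neighbours (mono_edges E \<chi>') (sv j) - sv ` {j<..<m}. \<omega> {sv j, u}) =
    incident_weight j (\<chi>' (sv j)) +
    (\<Sum>l | l < j \<and> \<chi>' (sv l) = \<chi>' (sv j). incident_weight j (c + 1 + l))"
proof -
  let ?q = "\<chi>' (sv j)" and ?N = "neighbours E (sv j)"
  define A where "A = {l. l < j \<and> \<chi>' (sv l) = ?q}"
  define Q where "Q = insert ?q ((\<lambda>l. c + 1 + l) ` A)"
  have "?q \<le> c"
    using col sv_in_V \<open>j < m\<close> by (auto simp: coloring_def)
  then have "neighbours (mono_edges E \<chi>') (sv j) - sv ` {j<..<m} = {u \<in> ?N. mark u \<in> Q}"
    unfolding neighbours_mono_edges Q_def A_def
    using charged_neighbour_iff_mark[OF col same \<open>j < m\<close>] by blast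
  then have "(\<Sum>u\<in>neighbours (mono_edges E \<chi>') (sv j) - sv ` {j<..<m}. \<omega> {sv j, u}) =
      (\<Sum>u | u \<in> ?N \<and> mark u \<in> Q. \<omega> {sv j, u})"
    by simp
  also have "\<dots> = (\<Sum>q\<in>Q. \<Sum>u | u \<in> {u \<in> ?N. mark u \<in> Q} \<and> mark u = q. \<omega> {sv j, u})"
    using finite_neighbours[OF graph] by (intro sum.group[symmetric]) (auto simp: Q_def A_def)
  also have "\<dots> = (\<Sum>q\<in>Q. incident_weight j q)"
    unfolding incident_weight_def by (intro sum.cong) auto
  also have "\<dots> = incident_weight j ?q + (\<Sum>q\<in>(\<lambda>l. c + 1 + l) ` A. incident_weight j q)"
    unfolding Q_def using \<open>?q \<le> c\<close> by (intro sum.insert) (auto simp: A_def)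
  also have "(\<Sum>q\<in>(\<lambda>l. c + 1 + l) ` A. incident_weight j q) = (\<Sum>l\<in>A. incident_weight j (c + 1 + l))"
    by (rule sum.reindex_cong) (auto simp: inj_on_def)
  finally show ?thesis
    by (simp add: A_def)
qed

lemma weight_cut_edges_recoloring:
  assumes col: "coloring V c \<chi>'" and same: "\<And>u. u \<in> V - sv ` {..<m} \<Longrightarrow> \<chi>' u = \<chi> u"
  shows "weight \<omega> (cut_edges E \<chi>') = weight \<omega> E -
    weight \<omega> (edges_avoiding (mono_edges E \<chi>) (sv ` {..<m})) -
    partition_cost color_cost (c - 1) {..<m} (\<lambda>j. \<chi>' (sv j) - 1)"
proof -
  let ?charge = "\<lambda>j q. incident_weight j q +
    (\<Sum>l | l < j \<and> \<chi>' (sv l) = q. incident_weight j (c + 1 + l))"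
  have color: "1 \<le> \<chi>' (sv j)" "\<chi>' (sv j) \<le> c" if "j < m" for j
    using col sv_in_V that by (auto simp: coloring_def)
  have "weight \<omega> (mono_edges E \<chi>') =
      weight \<omega> (edges_avoiding (mono_edges E \<chi>) (sv ` {..<m})) + (\<Sum>j<m. ?charge j (\<chi>' (sv j)))"
    using weight_charged_to_last_endpoint[OF graph_mono_edges[OF graph] inj_sv, of \<omega> \<chi>']
      edges_avoiding_mono_edges_cong[OF graph same] charge_eq_incident_weights[OF col same]
    by simp
  also have "(\<Sum>j<m. ?charge j (\<chi>' (sv j))) =
      (\<Sum>i\<le>c - 1. \<Sum>j | j \<in> {..<m} \<and> \<chi>' (sv j) - 1 = i. ?charge j (\<chi>' (sv j)))"
    using color by (intro sum.group[symmetric]) (auto intro: diff_le_mono)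
  also have "\<dots> = partition_cost color_cost (c - 1) {..<m} (\<lambda>j. \<chi>' (sv j) - 1)"
    unfolding partition_cost_def class_cost_def
  proof (intro sum.cong refl)
    fix i j assume j: "j \<in> {j. j \<in> {..<m} \<and> \<chi>' (sv j) - 1 = i}"
    then have "\<chi>' (sv j) = Suc i"
      using color[of j] by auto
    moreover have "\<chi>' (sv l) = Suc i \<longleftrightarrow> \<chi>' (sv l) - 1 = i" if "l < m" for l
      using color[OF that] by auto
    then have "{l. l < j \<and> \<chi>' (sv l) = Suc i} = {l \<in> {..<m}. \<chi>' (sv l) - 1 = i} \<inter> {..<j}"
      using j by auto
    ultimately show "?charge j (\<chi>' (sv j)) = incident_weight j (Suc i) +
        (\<Sum>l\<in>{l \<in> {..<m}. \<chi>' (sv l) - 1 = i} \<inter> {..<j}. incident_weight j (c + 1 + l))"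
      by simp
  qed
  finally show ?thesis
    unfolding weight_cut_edges_eq[OF finite_edges[OF graph]] by simp
qed

lemma optimal_partition_imp_weight_cut_edges_le:
  assumes col: "coloring V c \<chi>'" and same: "\<And>u. u \<in> V - sv ` {..<m} \<Longrightarrow> \<chi>' u = \<chi> u"
    and opt: "optimal_partition color_cost (c - 1) {..<m} (\<lambda>j. \<chi>' (sv j) - 1)"
    and col': "coloring V c \<chi>''" and same': "\<And>u. u \<in> V - sv ` {..<m} \<Longrightarrow> \<chi>'' u = \<chi> u"
  shows "weight \<omega> (cut_edges E \<chi>'') \<le> weight \<omega> (cut_edges E \<chi>')"
proof -
  have "(\<lambda>j. \<chi>'' (sv j) - 1) ` {..<m} \<subseteq> {..c - 1}"
    using col' sv_in_V by (auto simp: coloring_def intro!: diff_le_mono)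
  then have "partition_cost color_cost (c - 1) {..<m} (\<lambda>j. \<chi>' (sv j) - 1) \<le>
      partition_cost color_cost (c - 1) {..<m} (\<lambda>j. \<chi>'' (sv j) - 1)"
    using opt by (simp add: optimal_partition_def min_cost_le_partition_cost)
  then show ?thesis
    using weight_cut_edges_recoloring[OF col same] weight_cut_edges_recoloring[OF col' same']
    by simp
qed

end

section \<open>Subsets as binary numbers\<close>

lemma set_decode_subset_lessThan:
  assumes "x < 2 ^ m"
  shows "set_decode x \<subseteq> {..<m}"
proof
  fix n assume "n \<in> set_decode x"
  then have "0 < x div 2 ^ n"
    unfolding set_decode_def mem_Collect_eq by (rule odd_pos)
  then have "2 ^ n \<le> x"
    by (simp add: div_greater_zero_iff)
  then have "(2::nat) ^ n < 2 ^ m"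
    using assms by (rule le_less_trans)
  then show "n \<in> {..<m}"
    by simp
qed

lemma set_decode_insert_greatest:
  "x < 2 ^ m \<Longrightarrow> set_decode (2 ^ m + x) = insert m (set_decode x)"
  using set_decode_subset_lessThan[of x m] by (intro set_decode_plus_power_2) auto

lemma set_decode_power_minus_1: "set_decode (2 ^ m - 1) = {..<m}"
proof (induction m)
  case (Suc m)
  have "set_decode (2 ^ Suc m - 1) = set_decode (2 ^ m + (2 ^ m - 1))"
    by (simp add: mult_2)
  also have "\<dots> = {..<Suc m}"
    unfolding lessThan_Suc Suc.IH[symmetric] by (rule set_decode_insert_greatest) simp
  finally show ?case .
qed simp

lemma set_decode_add:
  assumes "set_decode x \<inter> set_decode y = {}"
  shows "set_decode (x + y) = set_decode x \<union> set_decode y"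
proof -
  have "set_encode (set_decode x \<union> set_decode y) =
      set_encode (set_decode x) + set_encode (set_decode y)"
    unfolding set_encode_def using assms by (simp add: sum.union_disjoint)
  then have "x + y = set_encode (set_decode x \<union> set_decode y)"
    by simp
  then show ?thesis
    by simp
qed

lemma set_decode_diff:
  assumes "set_decode y \<subseteq> set_decode x"
  shows "set_decode (x - y) = set_decode x - set_decode y"
proof -
  define z where "z = set_encode (set_decode x - set_decode y)"
  have z: "set_decode z = set_decode x - set_decode y"
    by (simp add: z_def)
  then have "set_decode (z + y) = set_decode x"
    using assms set_decode_add[of z y] by auto
  then have "z + y = x"
    by (metis set_decode_inverse)
  then have "x - y = z"
    by simp
  then show ?thesis
    by (simp only: z)
qed

definition subset_table :: "(nat \<Rightarrow> 'a) \<Rightarrow> nat \<Rightarrow> (nat set \<Rightarrow> 'a) \<Rightarrow> bool" where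
  "subset_table r m f \<longleftrightarrow> (\<forall>x<2 ^ m. r x = f (set_decode x))"

lemma subset_table_0: "subset_table r 0 f \<longleftrightarrow> r 0 = f {}"
  by (simp add: subset_table_def)

lemma subset_table_SucI:
  assumes "subset_table r m f" "\<And>x. x < 2 ^ m \<Longrightarrow> r (2 ^ m + x) = f (insert m (set_decode x))"
  shows "subset_table r (Suc m) f"
  unfolding subset_table_def
proof (intro allI impI)
  fix x :: nat assume "x < 2 ^ Suc m"
  then consider "x < 2 ^ m" | y where "x = 2 ^ m + y" "y < 2 ^ m"
    by (cases "x < 2 ^ m") (auto simp: not_less dest!: le_Suc_ex)
  then show "r x = f (set_decode x)"
    by cases (use assms in \<open>simp_all add: subset_table_def set_decode_insert_greatest\<close>)
qed

definition disjoint_pairs :: "'a set \<Rightarrow> ('a set \<times> 'a set) set" where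
  "disjoint_pairs A = {(X, Y). X \<subseteq> A \<and> Y \<subseteq> A \<and> X \<inter> Y = {}}"

lemma disjoint_pairs_empty: "disjoint_pairs {} = {({}, {})}"
  by (auto simp: disjoint_pairs_def)

lemma disjoint_pairs_insert:
  assumes "a \<notin> A"
  shows "disjoint_pairs (insert a A) = disjoint_pairs A \<union>
    map_prod (insert a) id ` disjoint_pairs A \<union> map_prod id (insert a) ` disjoint_pairs A"
    (is "_ = ?R")
proof
  show "disjoint_pairs (insert a A) \<subseteq> ?R"
  proof
    fix p assume p: "p \<in> disjoint_pairs (insert a A)"
    obtain X Y where [simp]: "p = (X, Y)"
      by (cases p)
    consider "a \<notin> X" "a \<notin> Y" | "a \<in> X" "a \<notin> Y" | "a \<notin> X" "a \<in> Y"
      using p by (auto simp: disjoint_pairs_def)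
    then show "p \<in> ?R"
    proof cases
      case 2
      then have "(X - {a}, Y) \<in> disjoint_pairs A"
        using p by (auto simp: disjoint_pairs_def)
      moreover have "p = map_prod (insert a) id (X - {a}, Y)"
        using 2 by auto
      ultimately show ?thesis
        by blast
    next
      case 3
      then have "(X, Y - {a}) \<in> disjoint_pairs A"
        using p by (auto simp: disjoint_pairs_def)
      moreover have "p = map_prod id (insert a) (X, Y - {a})"
        using 3 by auto
      ultimately show ?thesis
        by blast
    qed (use p in \<open>auto simp: disjoint_pairs_def\<close>)
  qed
qed (use assms in \<open>auto simp: disjoint_pairs_def\<close>)

section \<open>Verifying running programs\<close>

definition runs :: "com \<Rightarrow> state \<Rightarrow> nat \<Rightarrow> (state \<Rightarrow> bool) \<Rightarrow> bool" where
  "runs P s T Q \<longleftrightarrow> (\<exists>t s'. exec P s t s' \<and> t \<le> T \<and> Q s')"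

fun nwrites :: "com \<Rightarrow> vname set" where
  "nwrites Skip = {}"
| "nwrites (NWrite x e f) = {x}"
| "nwrites (RWrite x e f) = {}"
| "nwrites (Seq P Q) = nwrites P \<union> nwrites Q"
| "nwrites (If b P Q) = nwrites P \<union> nwrites Q"
| "nwrites (While b P) = nwrites P"

fun rwrites :: "com \<Rightarrow> vname set" where
  "rwrites Skip = {}"
| "rwrites (NWrite x e f) = {}"
| "rwrites (RWrite x e f) = {x}"
| "rwrites (Seq P Q) = rwrites P \<union> rwrites Q"
| "rwrites (If b P Q) = rwrites P \<union> rwrites Q"
| "rwrites (While b P) = rwrites P"

definition frame :: "com \<Rightarrow> state \<Rightarrow> state \<Rightarrow> bool" where
  "frame P s s' \<longleftrightarrow> (\<forall>x. x \<notin> nwrites P \<longrightarrow> nmem s' x = nmem s x) \<and>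
     (\<forall>x. x \<notin> rwrites P \<longrightarrow> rmem s' x = rmem s x)"

lemma nmem_nwrite [simp]: "nmem (nwrite x i n s) = (nmem s)(x := (nmem s x)(i := n))"
  and rmem_nwrite [simp]: "rmem (nwrite x i n s) = rmem s"
  and nmem_rwrite [simp]: "nmem (rwrite x i q s) = nmem s"
  and rmem_rwrite [simp]: "rmem (rwrite x i q s) = (rmem s)(x := (rmem s x)(i := q))"
  by (simp_all add: nwrite_def rwrite_def)

lemma frameD:
  assumes "frame P s s'"
  shows "x \<notin> nwrites P \<Longrightarrow> nmem s' x = nmem s x" "x \<notin> rwrites P \<Longrightarrow> rmem s' x = rmem s x"
  using assms by (simp_all add: frame_def)

lemma frame_trans: "frame P s s' \<Longrightarrow> frame P s' s'' \<Longrightarrow> frame P s s''"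
  by (simp add: frame_def)

lemma exec_frame: "exec P s t s' \<Longrightarrow> frame P s s'"
  by (induction rule: exec.induct) (auto simp: frame_def)

inductive_simps exec_simps:
  "exec Skip s t s'" "exec (NWrite x e f) s t s'" "exec (RWrite x e f) s t s'"
  "exec (Seq P Q) s t s'" "exec (If b P Q) s t s'"

lemma exec_While_iff: "exec (While b P) s t s' \<longleftrightarrow>
    (if bval b s then \<exists>u. t = 1 + u \<and> exec (Seq P (While b P)) s u s' else t = 1 \<and> s' = s)"
  by (subst exec.simps) (auto simp: exec_simps)

lemma runs_Skip [simp]: "runs Skip s T Q \<longleftrightarrow> 1 \<le> T \<and> Q s"
  by (simp add: runs_def exec_simps)

lemma runs_NWrite [simp]:
  "runs (NWrite x e f) s T Q \<longleftrightarrow> 1 \<le> T \<and> Q (nwrite x (nval e s) (nval f s) s)"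
  by (simp add: runs_def exec_simps)

lemma runs_RWrite [simp]:
  "runs (RWrite x e f) s T Q \<longleftrightarrow> 1 \<le> T \<and> Q (rwrite x (nval e s) (rval f s) s)"
  by (simp add: runs_def exec_simps)

lemma runs_If [simp]:
  "runs (If b P Q) s T R \<longleftrightarrow>
    1 \<le> T \<and> (if bval b s then runs P s (T - 1) R else runs Q s (T - 1) R)"
  by (cases T; cases "bval b s") (auto simp: runs_def exec_simps)

lemma runs_While:
  "runs (While b P) s T Q \<longleftrightarrow>
    1 \<le> T \<and> (if bval b s then runs (Seq P (While b P)) s (T - 1) Q else Q s)"
  unfolding runs_def exec_While_iff by (cases T; cases "bval b s") auto

lemma runs_Seq_NWrite [simp]:
  "runs (Seq (NWrite x e f) P) s T Q \<longleftrightarrow>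
    1 \<le> T \<and> runs P (nwrite x (nval e s) (nval f s) s) (T - 1) Q"
  by (cases T) (auto simp: runs_def exec_simps)

lemma runs_Seq_RWrite [simp]:
  "runs (Seq (RWrite x e f) P) s T Q \<longleftrightarrow>
    1 \<le> T \<and> runs P (rwrite x (nval e s) (rval f s) s) (T - 1) Q"
  by (cases T) (auto simp: runs_def exec_simps)

lemma runs_mono:
  "runs P s T Q \<Longrightarrow> T \<le> T' \<Longrightarrow> (\<And>s'. frame P s s' \<Longrightarrow> Q s' \<Longrightarrow> Q' s') \<Longrightarrow> runs P s T' Q'"
  unfolding runs_def using exec_frame order_trans by meson

lemma runs_Seq [consumes 1, case_names rest time]:
  assumes "runs P s T R" "\<And>s'. frame P s s' \<Longrightarrow> R s' \<Longrightarrow> runs Q s' T' Q'" "T + T' \<le> U"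
  shows "runs (Seq P Q) s U Q'"
proof -
  obtain t s' where first: "exec P s t s'" "t \<le> T" "R s'"
    using assms(1) unfolding runs_def by blast
  then obtain t' s'' where second: "exec Q s' t' s''" "t' \<le> T'" "Q' s''"
    using assms(2) exec_frame unfolding runs_def by blast
  have "exec (Seq P Q) s (t + t') s''" "t + t' \<le> U"
    using first second assms(3) by (auto intro: exec.Seq)
  then show ?thesis
    unfolding runs_def using second(3) by blast
qed

abbreviation seq :: "com \<Rightarrow> com \<Rightarrow> com" (infixr \<open>;;\<close> 60) where "P ;; Q \<equiv> Seq P Q"

abbreviation var :: "vname \<Rightarrow> nexp" where "var x \<equiv> NRead x (NConst 0)"

abbreviation assign :: "vname \<Rightarrow> nexp \<Rightarrow> com" where "assign x e \<equiv> NWrite x (NConst 0) e"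

definition For :: "vname \<Rightarrow> nexp \<Rightarrow> com \<Rightarrow> com" where
  "For x e P = assign x (NConst 0) ;;
     While (NLess (var x) e) (P ;; assign x (NPlus (var x) (NConst 1)))"

lemma writes_For [simp]:
  "nwrites (For x e P) = insert x (nwrites P)" "rwrites (For x e P) = rwrites P"
  by (auto simp: For_def)

lemma runs_For_body:
  assumes "x \<notin> nwrites P" "nmem s x 0 = j" "runs P s B (\<lambda>s'. I (Suc j) (nwrite x 0 (Suc j) s'))"
  shows "runs (P ;; assign x (NPlus (var x) (NConst 1))) s (B + 1)
    (\<lambda>s'. I (Suc j) s' \<and> nmem s' x 0 = Suc j)"
  using assms(3)
proof (induct rule: runs_Seq[where T' = 1])
  case (rest s')
  then show ?case
    using assms(1,2) by (simp add: frameD)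
qed simp

lemma runs_For [case_names counter bound init step time post]:
  assumes counter: "x \<notin> nwrites P"
    and bound: "\<And>s'. frame (For x e P) s s' \<Longrightarrow> nval e s' = n"
    and init: "I 0 (nwrite x 0 0 s)"
    and body: "\<And>j s'. j < n \<Longrightarrow> frame (For x e P) s s' \<Longrightarrow> nmem s' x 0 = j \<Longrightarrow> I j s' \<Longrightarrow>
      runs P s' B (\<lambda>s''. I (Suc j) (nwrite x 0 (Suc j) s''))"
    and time: "n * (B + 2) + 2 \<le> T"
    and post: "\<And>s'. frame (For x e P) s s' \<Longrightarrow> I n s' \<Longrightarrow> Q s'"
  shows "runs (For x e P) s T Q"
proof -
  let ?body = "P ;; assign x (NPlus (var x) (NConst 1))"
  let ?loop = "While (NLess (var x) e) ?body"
  have loop: "runs ?loop s' ((n - j) * (B + 2) + 1) (I n)"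
    if "j \<le> n" "frame (For x e P) s s'" "nmem s' x 0 = j" "I j s'" for j s'
    using that
  proof (induction j arbitrary: s' rule: inc_induct)
    case base
    then have "\<not> bval (NLess (var x) e) s'"
      using bound by simp
    then show ?case
      using base by (subst runs_While) simp
  next
    case (step j)
    have "runs ?body s' (B + 1) (\<lambda>r. I (Suc j) r \<and> nmem r x 0 = Suc j)"
      using counter body step.hyps(2) step.prems by (intro runs_For_body) auto
    then have "runs (?body ;; ?loop) s' ((n - j) * (B + 2)) (I n)"
    proof (induct rule: runs_Seq[where T' = "(n - Suc j) * (B + 2) + 1"])
      case (rest r)
      then have "frame (For x e P) s' r"
        by (simp add: frame_def)
      then show ?case
        using step.IH frame_trans[OF step.prems(1)] rest(2) by blast
    next
      case time
      have rounds: "n - j = 1 + (n - Suc j)"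
        using step.hyps by simp
      show ?case
        unfolding rounds distrib_right by simp
    qed
    moreover have "bval (NLess (var x) e) s'"
      using step.hyps(2) step.prems(1,2) bound by simp
    ultimately show ?case
      by (subst runs_While) simp
  qed
  have "frame (For x e P) s (nwrite x 0 0 s)"
    by (simp add: frame_def)
  then have "runs ?loop (nwrite x 0 0 s) (n * (B + 2) + 1) (I n)"
    using loop[of 0 "nwrite x 0 0 s"] init by simp
  then have "runs (For x e P) s (n * (B + 2) + 2) (I n)"
    unfolding For_def by simp
  then show ?thesis
    by (rule runs_mono[OF _ time post])
qed

section \<open>Preparing the machine\<close>

abbreviation card_S :: nexp where "card_S \<equiv> var ''size''"

definition layout :: "nat \<Rightarrow> nat \<Rightarrow> state \<Rightarrow> bool" where
  "layout m c s \<longleftrightarrow> nmem s ''size'' 0 = m \<and> nmem s ''c'' 0 = c \<and>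
    (\<forall>j\<le>m. nmem s ''pow'' j = 2 ^ j \<and> nmem s ''row'' j = j * (c + m + 1))"

lemma layoutD:
  assumes "layout m c s"
  shows "nmem s ''size'' 0 = m" "nmem s ''c'' 0 = c"
    "j \<le> m \<Longrightarrow> nmem s ''pow'' j = 2 ^ j" "j \<le> m \<Longrightarrow> nmem s ''row'' j = j * (c + m + 1)"
  using assms by (simp_all add: layout_def)

definition init_layout :: com where
  "init_layout = NWrite ''pow'' (NConst 0) (NConst 1) ;;
    NWrite ''row'' (NConst 0) (NConst 0) ;;
    For ''j'' card_S
     (NWrite ''pow'' (NPlus (var ''j'') (NConst 1))
        (NPlus (NRead ''pow'' (var ''j'')) (NRead ''pow'' (var ''j''))) ;;
      NWrite ''row'' (NPlus (var ''j'') (NConst 1))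
        (NPlus (NRead ''row'' (var ''j'')) (NPlus (var ''c'') (NPlus card_S (NConst 1)))))"

lemma writes_init_layout [simp]:
  "nwrites init_layout = {''pow'', ''row'', ''j''}" "rwrites init_layout = {}"
  by (auto simp: init_layout_def)

lemma runs_init_layout:
  assumes "nmem s ''size'' 0 = m" "nmem s ''c'' 0 = c"
  shows "runs init_layout s (m * 4 + 4) (layout m c)"
proof -
  define I where "I n s' \<longleftrightarrow>
    (\<forall>j\<le>n. nmem s' ''pow'' j = 2 ^ j \<and> nmem s' ''row'' j = j * (c + m + 1))" for n and s' :: state
  show ?thesis
    unfolding init_layout_def
  proof (simp, induct rule: runs_For[where n = m and I = I and B = 2])
    case (step j s')
    note [simp] = frameD[OF step(2), simplified]
    show ?case
      using step(1,3,4) assms by (simp add: I_def le_Suc_eq)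
  next
    case (post s')
    note [simp] = frameD[OF post(1), simplified]
    show ?case
      using post(2) assms by (simp add: I_def layout_def)
  qed (use assms in \<open>simp_all add: I_def frameD\<close>)
qed

lemma layout_frame:
  assumes "frame P s s'" "layout m c s" "nwrites P \<inter> {''size'', ''c'', ''pow'', ''row''} = {}"
  shows "layout m c s'"
  using assms(2,3) by (auto simp: layout_def frameD[OF assms(1)])

lemma layout_nwrite [simp]:
  "x \<notin> {''size'', ''c'', ''pow'', ''row''} \<Longrightarrow> layout m c (nwrite x i n s) \<longleftrightarrow> layout m c s"
  by (auto simp: layout_def)

definition mark_vertices :: com where
  "mark_vertices = For ''j'' card_S
    (NWrite ''col'' (NRead ''S'' (var ''j'')) (NPlus (var ''c'') (NPlus (NConst 1) (var ''j''))))"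

lemma writes_mark_vertices [simp]:
  "nwrites mark_vertices = {''col'', ''j''}" "rwrites mark_vertices = {}"
  by (auto simp: mark_vertices_def)

abbreviation vertex_color :: "state \<Rightarrow> nat \<Rightarrow> nat" where
  "vertex_color s j \<equiv> nmem s ''col'' (nmem s ''S'' j)"

definition same_outside_S :: "nat \<Rightarrow> state \<Rightarrow> state \<Rightarrow> bool" where
  "same_outside_S m s s' \<longleftrightarrow>
    (\<forall>u. u \<notin> nmem s ''S'' ` {..<m} \<longrightarrow> nmem s' ''col'' u = nmem s ''col'' u)"

lemma runs_mark_vertices:
  assumes layout: "layout m c s" and inj: "inj_on (nmem s ''S'') {..<m}"
  shows "runs mark_vertices s (m * 3 + 2)
    (\<lambda>s'. (\<forall>j<m. vertex_color s' j = c + 1 + j) \<and> same_outside_S m s s')"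
proof -
  note [simp] = layoutD[OF layout]
  define I where "I n s' \<longleftrightarrow>
    (\<forall>j<n. nmem s' ''col'' (nmem s ''S'' j) = c + 1 + j) \<and> same_outside_S m s s'" for n s'
  show ?thesis
    unfolding mark_vertices_def
  proof (induct rule: runs_For[where n = m and I = I and B = 1])
    case (step j s')
    note [simp] = frameD[OF step(2), simplified]
    have "nmem s ''S'' i \<noteq> nmem s ''S'' j" if "i < j" for i
      using inj_onD[OF inj, of i j] step(1) that by auto
    then show ?case
      using step(1,3,4) by (auto simp: I_def same_outside_S_def less_Suc_eq)
  qed (simp_all add: I_def same_outside_S_def frameD)
qed

section \<open>Collecting the incident weights\<close>

abbreviation vertex :: nexp where "vertex \<equiv> NRead ''S'' (var ''j'')"

abbreviation slot :: nexp where "slot \<equiv> NPlus (NRead ''start'' vertex) (var ''p'')"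

abbreviation weight_cell :: nexp where
  "weight_cell \<equiv> NPlus (NRead ''row'' (var ''j'')) (NRead ''col'' (NRead ''adj'' slot))"

definition nth_neighbour :: "state \<Rightarrow> nat \<Rightarrow> nat \<Rightarrow> nat" where
  "nth_neighbour s j p = nmem s ''adj'' (nmem s ''start'' (nmem s ''S'' j) + p)"

definition nth_weight :: "state \<Rightarrow> nat \<Rightarrow> nat \<Rightarrow> rat" where
  "nth_weight s j p = rmem s ''wt'' (nmem s ''start'' (nmem s ''S'' j) + p)"

definition weight_cell_sum :: "state \<Rightarrow> nat \<Rightarrow> nat \<Rightarrow> nat \<Rightarrow> rat" where
  "weight_cell_sum s j d x =
    (\<Sum>p | p < d \<and> nmem s ''row'' j + nmem s ''col'' (nth_neighbour s j p) = x. nth_weight s j p)"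

definition collect_row :: com where
  "collect_row = For ''p'' (NRead ''deg'' vertex)
     (RWrite ''weight'' weight_cell (RPlus (RRead ''weight'' weight_cell) (RRead ''wt'' slot)))"

lemma writes_collect_row [simp]:
  "nwrites collect_row = {''p''}" "rwrites collect_row = {''weight''}"
  by (auto simp: collect_row_def)

lemma weight_cell_sum_0 [simp]: "weight_cell_sum s j 0 x = 0"
  by (simp add: weight_cell_sum_def)

lemma weight_cell_sum_Suc:
  "weight_cell_sum s j (Suc n) x = weight_cell_sum s j n x +
    (if nmem s ''row'' j + nmem s ''col'' (nth_neighbour s j n) = x then nth_weight s j n else 0)"
proof -
  let ?hit = "\<lambda>p. nmem s ''row'' j + nmem s ''col'' (nth_neighbour s j p) = x"
  have "{p. p < Suc n \<and> ?hit p} = (if ?hit n then {n} else {}) \<union> {p. p < n \<and> ?hit p}"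
    by (auto simp: less_Suc_eq)
  then show ?thesis
    by (simp add: weight_cell_sum_def add.commute)
qed

lemma runs_collect_row:
  assumes "nmem s ''j'' 0 = j" "nmem s ''deg'' (nmem s ''S'' j) = d"
  shows "runs collect_row s (d * 3 + 2) (\<lambda>s'.
    \<forall>x. rmem s' ''weight'' x = rmem s ''weight'' x + weight_cell_sum s j d x)"
proof -
  define I where "I n s' \<longleftrightarrow>
    (\<forall>x. rmem s' ''weight'' x = rmem s ''weight'' x + weight_cell_sum s j n x)"
    for n and s' :: state
  show ?thesis
    unfolding collect_row_def
  proof (induct rule: runs_For[where n = d and I = I and B = 1])
    case (step n s')
    note [simp] = frameD[OF step(2), simplified] step(3) assms
    show ?case
      using step(4)
      by (simp add: I_def weight_cell_sum_Suc nth_neighbour_def[of s j n] nth_weight_def[of s j n])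
  qed (simp_all add: I_def frameD assms)
qed

definition collect_weights :: com where
  "collect_weights = For ''j'' card_S collect_row"

lemma writes_collect_weights [simp]:
  "nwrites collect_weights = {''j'', ''p''}" "rwrites collect_weights = {''weight''}"
  by (auto simp: collect_weights_def)

definition weight_table :: "nat \<Rightarrow> nat \<Rightarrow> (nat \<Rightarrow> nat \<Rightarrow> rat) \<Rightarrow> state \<Rightarrow> bool" where
  "weight_table m c w s \<longleftrightarrow>
    (\<forall>j<m. \<forall>q<c + m + 1. rmem s ''weight'' (j * (c + m + 1) + q) = w j q)"

lemma row_address_eq_iff:
  fixes K :: nat
  assumes "q < K" "q' < K"
  shows "i * K + q = j * K + q' \<longleftrightarrow> i = j \<and> q = q'"
proof
  assume eq: "i * K + q = j * K + q'"
  then have "(i * K + q) div K = (j * K + q') div K"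
    by simp
  then have "i = j"
    using assms by simp
  then show "i = j \<and> q = q'"
    using eq by simp
qed simp

lemma weight_cell_sum_row_address:
  assumes layout: "layout m c s" and "i < m" "q < c + m + 1"
    and color: "\<And>p. p < d \<Longrightarrow> nmem s ''col'' (nth_neighbour s i p) < c + m + 1"
  shows "weight_cell_sum s i d (j * (c + m + 1) + q) =
    (if i = j then \<Sum>p | p < d \<and> nmem s ''col'' (nth_neighbour s j p) = q. nth_weight s j p else 0)"
proof -
  have "{p. p < d \<and> nmem s ''row'' i + nmem s ''col'' (nth_neighbour s i p) = j * (c + m + 1) + q} =
      (if i = j then {p. p < d \<and> nmem s ''col'' (nth_neighbour s j p) = q} else {})"
    using row_address_eq_iff[OF color \<open>q < c + m + 1\<close>] \<open>i < m\<close> by (auto simp: layoutD[OF layout])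
  then show ?thesis
    by (simp add: weight_cell_sum_def)
qed

lemma runs_collect_weights:
  assumes layout: "layout m c s" and init: "rmem s ''weight'' = (\<lambda>_. 0)"
    and deg: "\<And>j. j < m \<Longrightarrow> nmem s ''deg'' (nmem s ''S'' j) = d j"
    and d_le: "\<And>j. j < m \<Longrightarrow> d j \<le> \<Delta>"
    and color: "\<And>j p. j < m \<Longrightarrow> p < d j \<Longrightarrow> nmem s ''col'' (nth_neighbour s j p) < c + m + 1"
  shows "runs collect_weights s (m * (\<Delta> * 3 + 4) + 2) (weight_table m c
    (\<lambda>j q. \<Sum>p | p < d j \<and> nmem s ''col'' (nth_neighbour s j p) = q. nth_weight s j p))"
proof -
  note [simp] = layoutD[OF layout]
  define I where "I n s' \<longleftrightarrow>
    (\<forall>x. rmem s' ''weight'' x = (\<Sum>i<n. weight_cell_sum s i (d i) x))" for n and s' :: state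
  show ?thesis
    unfolding collect_weights_def
  proof (induct rule: runs_For[where n = m and I = I and B = "\<Delta> * 3 + 2"])
    case (step j s')
    note [simp] = frameD[OF step(2), simplified] step(3)
    have "runs collect_row s' (d j * 3 + 2) (\<lambda>r.
      \<forall>x. rmem r ''weight'' x = rmem s' ''weight'' x + weight_cell_sum s' j (d j) x)"
      using deg[OF step(1)] by (intro runs_collect_row) simp_all
    then show ?case
      by (rule runs_mono)
        (use step(4) d_le[OF step(1)] in
          \<open>simp_all add: I_def weight_cell_sum_def nth_neighbour_def nth_weight_def\<close>)
  next
    case (post s')
    show ?case
      unfolding weight_table_def
    proof (intro allI impI)
      fix j q assume "j < m" "q < c + m + 1"
      then show "rmem s' ''weight'' (j * (c + m + 1) + q) =
          (\<Sum>p | p < d j \<and> nmem s ''col'' (nth_neighbour s j p) = q. nth_weight s j p)"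
        using post(2) weight_cell_sum_row_address[OF layout _ _ color] by (simp add: I_def)
    qed
  next
    case time
    show ?case
      by (simp add: algebra_simps)
  qed (simp_all add: I_def frameD init)
qed

section \<open>Listing the pairs of disjoint subsets\<close>

definition code_pair :: "state \<Rightarrow> nat \<Rightarrow> nat \<times> nat" where
  "code_pair s l = (nmem s ''rest'' l, nmem s ''class'' l)"

definition set_pair :: "state \<Rightarrow> nat \<Rightarrow> nat set \<times> nat set" where
  "set_pair s l = map_prod set_decode set_decode (code_pair s l)"

definition lists_pairs :: "nat \<Rightarrow> state \<Rightarrow> bool" where
  "lists_pairs m s \<longleftrightarrow>
    nmem s ''pairs'' 0 = 3 ^ m \<and> set_pair s ` {..<3 ^ m} = disjoint_pairs {..<m}"

lemma lists_pairs_cong: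
  assumes "nmem s' ''pairs'' = nmem s ''pairs''" "nmem s' ''rest'' = nmem s ''rest''"
    "nmem s' ''class'' = nmem s ''class''"
  shows "lists_pairs m s' \<longleftrightarrow> lists_pairs m s"
  by (simp add: lists_pairs_def set_pair_def[abs_def] code_pair_def assms)

lemma lists_pairs_frame:
  "frame P s s' \<Longrightarrow> lists_pairs m s \<Longrightarrow> nwrites P \<inter> {''pairs'', ''rest'', ''class''} = {} \<Longrightarrow>
    lists_pairs m s'"
  by (subst lists_pairs_cong) (auto simp: frameD)

lemma lists_pairs_nwrite [simp]:
  "x \<notin> {''pairs'', ''rest'', ''class''} \<Longrightarrow> lists_pairs m (nwrite x i n s) \<longleftrightarrow> lists_pairs m s"
  by (rule lists_pairs_cong) auto

definition extend_pairs :: com where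
  "extend_pairs = For ''l'' (var ''pairs'')
    (NWrite ''rest'' (NPlus (var ''pairs'') (var ''l''))
       (NPlus (NRead ''pow'' (var ''j'')) (NRead ''rest'' (var ''l''))) ;;
     NWrite ''class'' (NPlus (var ''pairs'') (var ''l'')) (NRead ''class'' (var ''l'')) ;;
     NWrite ''rest'' (NPlus (NPlus (var ''pairs'') (var ''pairs'')) (var ''l''))
       (NRead ''rest'' (var ''l'')) ;;
     NWrite ''class'' (NPlus (NPlus (var ''pairs'') (var ''pairs'')) (var ''l''))
       (NPlus (NRead ''pow'' (var ''j'')) (NRead ''class'' (var ''l''))))"

lemma writes_extend_pairs [simp]:
  "nwrites extend_pairs = {''l'', ''rest'', ''class''}" "rwrites extend_pairs = {}"
  by (auto simp: extend_pairs_def)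

definition pairs_extended :: "nat \<Rightarrow> nat \<Rightarrow> state \<Rightarrow> state \<Rightarrow> bool" where
  "pairs_extended L b s s' \<longleftrightarrow> (\<forall>l<L. code_pair s' l = code_pair s l \<and>
    code_pair s' (L + l) = map_prod ((+) b) id (code_pair s l) \<and>
    code_pair s' (L + L + l) = map_prod id ((+) b) (code_pair s l))"

lemma runs_extend_pairs:
  assumes scalars: "nmem s ''pairs'' 0 = L" "nmem s ''j'' 0 = j" and pow: "nmem s ''pow'' j = b"
  shows "runs extend_pairs s (L * 6 + 2) (pairs_extended L b s)"
proof -
  define I where "I n s' \<longleftrightarrow> (\<forall>l<L. code_pair s' l = code_pair s l) \<and>
    (\<forall>l<n. code_pair s' (L + l) = map_prod ((+) b) id (code_pair s l) \<and>
      code_pair s' (L + L + l) = map_prod id ((+) b) (code_pair s l))" for n and s' :: state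
  show ?thesis
    unfolding extend_pairs_def
  proof (induct rule: runs_For[where n = L and I = I and B = 4])
    case (step n s')
    note [simp] = frameD[OF step(2), simplified] step(3) scalars pow
    show ?case
      using step(1,4) by (auto simp: I_def code_pair_def less_Suc_eq)
  qed (simp_all add: I_def pairs_extended_def frameD scalars code_pair_def)
qed

lemma pairs_extended_imp_disjoint_pairs_Suc:
  assumes old: "set_pair s ` {..<L} = disjoint_pairs {..<j}"
    and new: "pairs_extended L (2 ^ j) s s'"
  shows "set_pair s' ` {..<3 * L} = disjoint_pairs {..<Suc j}"
proof -
  have extend: "set_pair s' l = set_pair s l \<and>
      set_pair s' (L + l) = map_prod (insert j) id (set_pair s l) \<and>
      set_pair s' (L + L + l) = map_prod id (insert j) (set_pair s l)" if l: "l < L" for l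
  proof -
    have "set_pair s l \<in> disjoint_pairs {..<j}"
      using old l by blast
    then have "j \<notin> set_decode (fst (code_pair s l))" "j \<notin> set_decode (snd (code_pair s l))"
      by (auto simp: set_pair_def disjoint_pairs_def map_prod_def split: prod.splits)
    then show ?thesis
      using new l
      by (cases "code_pair s l") (simp add: pairs_extended_def set_pair_def set_decode_plus_power_2)
  qed
  have "{..<3 * L} = {..<L} \<union> (+) L ` {..<L} \<union> (+) (L + L) ` {..<L}"
    by (auto simp: lessThan_atLeast0 image_add_atLeastLessThan)
  then have "set_pair s' ` {..<3 * L} = set_pair s ` {..<L} \<union>
      map_prod (insert j) id ` set_pair s ` {..<L} \<union> map_prod id (insert j) ` set_pair s ` {..<L}"
    using extend by (simp add: image_Un image_image)
  also have "\<dots> = disjoint_pairs (insert j {..<j})"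
    unfolding old by (rule disjoint_pairs_insert[symmetric]) simp
  finally show ?thesis
    by (simp add: lessThan_Suc)
qed

definition list_pairs :: com where
  "list_pairs = NWrite ''rest'' (NConst 0) (NConst 0) ;;
    NWrite ''class'' (NConst 0) (NConst 0) ;;
    assign ''pairs'' (NConst 1) ;;
    For ''j'' card_S
     (extend_pairs ;;
      assign ''pairs'' (NPlus (var ''pairs'') (NPlus (var ''pairs'') (var ''pairs''))))"

lemma writes_list_pairs [simp]:
  "nwrites list_pairs = {''j'', ''pairs'', ''l'', ''rest'', ''class''}" "rwrites list_pairs = {}"
  by (auto simp: list_pairs_def)

lemma runs_list_pairs:
  assumes layout: "layout m c s"
  shows "runs list_pairs s (m * (3 ^ m * 6 + 5) + 5) (lists_pairs m)"
proof -
  note [simp] = layoutD[OF layout]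
  show ?thesis
    unfolding list_pairs_def
  proof (simp, induct rule: runs_For[where n = m and I = lists_pairs and B = "3 ^ m * 6 + 3"])
    case init
    show ?case
      by (simp add: lists_pairs_def set_pair_def code_pair_def disjoint_pairs_empty lessThan_Suc)
  next
    case (step j s')
    note [simp] = frameD[OF step(2), simplified] step(3)
    have pairs: "nmem s' ''pairs'' 0 = 3 ^ j" "set_pair s' ` {..<3 ^ j} = disjoint_pairs {..<j}"
      using step(4) by (simp_all add: lists_pairs_def)
    have "runs extend_pairs s' (3 ^ j * 6 + 2) (pairs_extended (3 ^ j) (2 ^ j) s')"
      using step(1) pairs by (intro runs_extend_pairs[where j = j]) (simp_all add: less_imp_le)
    then show ?case
    proof (induct rule: runs_Seq[where T' = 1])
      case (rest r)
      note [simp] = frameD[OF rest(1), simplified]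
      have "set_pair r ` {..<3 * 3 ^ j} = disjoint_pairs {..<Suc j}"
        using pairs(2) rest(2) by (rule pairs_extended_imp_disjoint_pairs_Suc)
      then show ?case
        using pairs(1) by (simp add: lists_pairs_def set_pair_def[abs_def] code_pair_def)
    qed (use step(1) in simp)
  qed (simp_all add: frameD)
qed

section \<open>Costs of the color classes\<close>

definition double_table :: "vname \<Rightarrow> nexp \<Rightarrow> rexp \<Rightarrow> com" where
  "double_table a l e = For ''y'' (NRead ''pow'' l)
     (RWrite a (NPlus (NRead ''pow'' l) (var ''y'')) (RPlus (RRead a (var ''y'')) e))"

lemma writes_double_table [simp]:
  "nwrites (double_table a l e) = {''y''}" "rwrites (double_table a l e) = {a}"
  by (auto simp: double_table_def)

lemma runs_double_table [case_names pow summand table time post]: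
  assumes pow: "\<And>s'. frame (double_table a l e) s s' \<Longrightarrow> nval (NRead ''pow'' l) s' = 2 ^ n"
    and summand: "\<And>y s'. y < 2 ^ n \<Longrightarrow> frame (double_table a l e) s s' \<Longrightarrow> nmem s' ''y'' 0 = y \<Longrightarrow>
      f (insert n (set_decode y)) = f (set_decode y) + rval e s'"
    and table: "subset_table (rmem s a) n f"
    and time: "2 ^ n * 3 + 2 \<le> T"
    and doubled: "\<And>s'. frame (double_table a l e) s s' \<Longrightarrow>
      subset_table (rmem s' a) (Suc n) f \<Longrightarrow> Q s'"
  shows "runs (double_table a l e) s T Q"
proof -
  define I where "I k s' \<longleftrightarrow> subset_table (rmem s' a) n f \<and>
    (\<forall>y<k. rmem s' a (2 ^ n + y) = f (insert n (set_decode y)))" for k and s' :: state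
  show ?thesis
    unfolding double_table_def
  proof (induct rule: runs_For[where n = "2 ^ n" and I = I and B = 1])
    case (step y s')
    have "frame (double_table a l e) s s'"
      using step(2) by (simp add: double_table_def)
    then have "nmem s' ''pow'' (nval l s') = 2 ^ n"
      "f (insert n (set_decode y)) = f (set_decode y) + rval e s'"
      using pow summand step(1,3) by auto
    then show ?case
      using step(1,3,4) by (auto simp: I_def subset_table_def less_Suc_eq)
  next
    case (post s')
    then have "frame (double_table a l e) s s'" "subset_table (rmem s' a) (Suc n) f"
      by (auto simp: I_def double_table_def intro: subset_table_SucI)
    then show ?case
      by (rule doubled)
  qed (use pow table time in \<open>simp_all add: I_def double_table_def\<close>)
qed

definition neighbour_table :: com where
  "neighbour_table =
    RWrite ''nbr'' (NConst 0)
      (RRead ''weight'' (NPlus (NRead ''row'' (var ''j'')) (var ''color''))) ;;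
    For ''l'' (var ''j'')
     (double_table ''nbr'' (var ''l'')
       (RRead ''weight'' (NPlus (NRead ''row'' (var ''j''))
         (NPlus (var ''c'') (NPlus (NConst 1) (var ''l''))))))"

lemma writes_neighbour_table [simp]:
  "nwrites neighbour_table = {''l'', ''y''}" "rwrites neighbour_table = {''nbr''}"
  by (auto simp: neighbour_table_def)

lemma runs_neighbour_table:
  assumes layout: "layout m c s" and weights: "weight_table m c w s"
    and scalars: "nmem s ''j'' 0 = j" "nmem s ''color'' 0 = q" and "j < m" "q \<le> c"
  shows "runs neighbour_table s (m * (2 ^ m * 3 + 4) + 3) (\<lambda>s'.
    subset_table (rmem s' ''nbr'') j (\<lambda>A. w j q + (\<Sum>l\<in>A. w j (c + 1 + l))))"
proof -
  let ?f = "\<lambda>A. w j q + (\<Sum>l\<in>A. w j (c + 1 + l))"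
  note [simp] = layoutD[OF layout] scalars
  have row: "rmem s ''weight'' (nmem s ''row'' j + x) = w j x" if "x < c + m + 1" for x
    using weights that \<open>j < m\<close> by (simp add: weight_table_def)
  show ?thesis
    unfolding neighbour_table_def
  proof (simp, induct rule: runs_For[where n = j
        and I = "\<lambda>l s'. subset_table (rmem s' ''nbr'') l ?f" and B = "2 ^ m * 3 + 2"])
    case init
    then show ?case
      using row[of q] \<open>q \<le> c\<close> by (simp add: subset_table_0)
  next
    case (step l s')
    note [simp] = frameD[OF step(2), simplified] step(3)
    have "l < m"
      using step(1) \<open>j < m\<close> by simp
    show ?case
    proof (induct rule: runs_double_table[where n = l and f = ?f])
      case (summand y r)
      note [simp] = frameD[OF summand(2), simplified]
      have "l \<notin> set_decode y"
        using set_decode_subset_lessThan[OF summand(1)] by auto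
      then show ?case
        using row[of "c + 1 + l"] \<open>l < m\<close> by (simp add: add.commute)
    qed (use step(4) \<open>l < m\<close> in \<open>simp_all add: frameD\<close>)
  next
    case time
    have "j * (2 ^ m * 3 + 4) \<le> m * (2 ^ m * 3 + 4)"
      using \<open>j < m\<close> by (intro mult_le_mono1) simp
    then show ?case
      by (simp add: algebra_simps)
  qed (simp_all add: frameD)
qed

definition add_vertex_costs :: com where
  "add_vertex_costs = neighbour_table ;;
    double_table ''cost'' (var ''j'') (RRead ''nbr'' (var ''y''))"

lemma writes_add_vertex_costs [simp]:
  "nwrites add_vertex_costs = {''l'', ''y''}" "rwrites add_vertex_costs = {''cost'', ''nbr''}"
  by (auto simp: add_vertex_costs_def)

definition add_vertex_costs_time :: "nat \<Rightarrow> nat" where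
  "add_vertex_costs_time m = (m * (2 ^ m * 3 + 4) + 3) + (2 ^ m * 3 + 2)"

lemma runs_add_vertex_costs:
  assumes layout: "layout m c s" and weights: "weight_table m c w s"
    and scalars: "nmem s ''j'' 0 = j" "nmem s ''color'' 0 = q" and "j < m" "q \<le> c"
    and cost: "subset_table (rmem s ''cost'') j (class_cost w c q)"
  shows "runs add_vertex_costs s (add_vertex_costs_time m)
    (\<lambda>s'. subset_table (rmem s' ''cost'') (Suc j) (class_cost w c q))"
  unfolding add_vertex_costs_def add_vertex_costs_time_def
  using runs_neighbour_table[OF layout weights scalars \<open>j < m\<close> \<open>q \<le> c\<close>]
proof (induct rule: runs_Seq[where T' = "2 ^ m * 3 + 2"])
  case (rest r)
  note [simp] = frameD[OF rest(1), simplified] layoutD[OF layout] scalars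
  show ?case
  proof (induct rule: runs_double_table[where n = j and f = "class_cost w c q"])
    case (summand y r')
    note [simp] = frameD[OF summand(2), simplified]
    show ?case
      using rest(2) summand(1,3)
        class_cost_insert_greatest[OF set_decode_subset_lessThan[OF summand(1)]]
      by (simp add: subset_table_def)
  qed (use \<open>j < m\<close> cost in \<open>simp_all add: frameD\<close>)
qed simp

definition class_costs :: com where
  "class_costs = RWrite ''cost'' (NConst 0) (RConst 0) ;; For ''j'' card_S add_vertex_costs"

lemma writes_class_costs [simp]:
  "nwrites class_costs = {''j'', ''l'', ''y''}" "rwrites class_costs = {''cost'', ''nbr''}"
  by (auto simp: class_costs_def)

definition class_costs_time :: "nat \<Rightarrow> nat" where
  "class_costs_time m = m * (add_vertex_costs_time m + 2) + 3"

lemma runs_class_costs: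
  assumes layout: "layout m c s" and weights: "weight_table m c w s"
    and color: "nmem s ''color'' 0 = q" "q \<le> c"
  shows "runs class_costs s (class_costs_time m)
    (\<lambda>s'. subset_table (rmem s' ''cost'') m (class_cost w c q))"
proof -
  note [simp] = layoutD[OF layout]
  show ?thesis
    unfolding class_costs_def class_costs_time_def
  proof (simp, induct rule: runs_For[where n = m and B = "add_vertex_costs_time m"
        and I = "\<lambda>j s'. subset_table (rmem s' ''cost'') j (class_cost w c q)"])
    case (step j s')
    note [simp] = frameD[OF step(2), simplified] step(3)
    have "layout m c s'" "weight_table m c w s'"
      using layout weights by (simp_all add: layout_def weight_table_def)
    then show ?case
      using step color by (simp add: runs_add_vertex_costs)
  qed (simp_all add: frameD subset_table_0 class_cost_def)
qed

section \<open>The table of minimal costs\<close>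

abbreviation best_from :: "state \<Rightarrow> nat \<Rightarrow> nat \<Rightarrow> rat" where
  "best_from s a \<equiv> \<lambda>x. rmem s ''best'' (a + x)"

abbreviation choice_from :: "state \<Rightarrow> nat \<Rightarrow> nat \<Rightarrow> nat" where
  "choice_from s a \<equiv> \<lambda>x. nmem s ''choice'' (a + x)"

text \<open>Level \<open>0\<close> records no choices, since there all vertices get the first color.\<close>

definition level_table :: "nat \<Rightarrow> (nat \<Rightarrow> nat set \<Rightarrow> rat) \<Rightarrow> nat \<Rightarrow> state \<Rightarrow> bool" where
  "level_table m g n s \<longleftrightarrow>
    (\<forall>i\<le>n. subset_table (best_from s (i * 2 ^ m)) m (min_cost g i)) \<and>
    (\<forall>i<n. \<forall>x<2 ^ m.
      optimal_class g i (set_decode x) (set_decode (choice_from s (Suc i * 2 ^ m) x)))"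

definition same_below :: "nat \<Rightarrow> state \<Rightarrow> state \<Rightarrow> bool" where
  "same_below a s s' \<longleftrightarrow>
    (\<forall>x<a. nmem s' ''choice'' x = nmem s ''choice'' x \<and> rmem s' ''best'' x = rmem s ''best'' x)"

definition level_filled ::
  "nat \<Rightarrow> (nat \<Rightarrow> nat set \<Rightarrow> rat) \<Rightarrow> nat \<Rightarrow> nat \<Rightarrow> state \<Rightarrow> state \<Rightarrow> bool" where
  "level_filled m g n a s s' \<longleftrightarrow> same_below a s s' \<and>
    subset_table (best_from s' a) m (min_cost g (Suc n)) \<and>
    (\<forall>x<2 ^ m. optimal_class g n (set_decode x) (set_decode (choice_from s' a x)))"

lemma level_table_Suc:
  assumes old: "level_table m g n s" and filled: "level_filled m g n (Suc n * 2 ^ m) s s'"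
  shows "level_table m g (Suc n) s'"
proof -
  have same_level: "best_from s' (i * 2 ^ m) x = best_from s (i * 2 ^ m) x \<and>
      choice_from s' (i * 2 ^ m) x = choice_from s (i * 2 ^ m) x" if "i \<le> n" "x < 2 ^ m" for i x
  proof -
    have "i * 2 ^ m + x < Suc i * 2 ^ m"
      using that(2) by simp
    also have "\<dots> \<le> Suc n * 2 ^ m"
      using that(1) by (intro mult_le_mono1) simp
    finally show ?thesis
      using filled by (simp add: level_filled_def same_below_def)
  qed
  have "subset_table (best_from s' (i * 2 ^ m)) m (min_cost g i)" if "i \<le> Suc n" for i
    using old filled same_level[of i] that
    by (cases "i = Suc n") (auto simp: level_table_def level_filled_def subset_table_def)
  moreover have "optimal_class g i (set_decode x) (set_decode (choice_from s' (Suc i * 2 ^ m) x))"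
    if "i < Suc n" "x < 2 ^ m" for i x
    using old filled same_level[of "Suc i" x] that
    by (cases "i = n") (auto simp: level_table_def level_filled_def)
  ultimately show ?thesis
    by (simp add: level_table_def)
qed

definition first_level :: com where
  "first_level = For ''x'' (NRead ''pow'' card_S)
    (RWrite ''best'' (var ''x'') (RRead ''cost'' (var ''x'')))"

lemma writes_first_level [simp]:
  "nwrites first_level = {''x''}" "rwrites first_level = {''best''}"
  by (auto simp: first_level_def)

lemma runs_first_level:
  assumes layout: "layout m c s" and cost: "subset_table (rmem s ''cost'') m (g 0)"
  shows "runs first_level s (2 ^ m * 3 + 2) (level_table m g 0)"
proof -
  note [simp] = layoutD[OF layout]
  show ?thesis
    unfolding first_level_def
  proof (induct rule: runs_For[where n = "2 ^ m" and B = 1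
        and I = "\<lambda>n s'. \<forall>x<n. rmem s' ''best'' x = rmem s ''cost'' x"])
    case (step n s')
    note [simp] = frameD[OF step(2), simplified] step(3)
    show ?case
      using step(4) by (simp add: less_Suc_eq)
  next
    case (post s')
    then show ?case
      using cost by (simp add: level_table_def subset_table_def)
  qed (simp_all add: frameD)
qed

abbreviation next_level :: nexp where
  "next_level \<equiv> NPlus (var ''level'') (NRead ''pow'' card_S)"

definition copy_level :: com where
  "copy_level = For ''x'' (NRead ''pow'' card_S)
    (RWrite ''best'' (NPlus next_level (var ''x''))
       (RPlus (RRead ''best'' (NPlus (var ''level'') (var ''x''))) (RRead ''cost'' (NConst 0))) ;;
     NWrite ''choice'' (NPlus next_level (var ''x'')) (NConst 0))"

lemma writes_copy_level [simp]:
  "nwrites copy_level = {''x'', ''choice''}" "rwrites copy_level = {''best''}"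
  by (auto simp: copy_level_def)

lemma runs_copy_level:
  assumes layout: "layout m c s" and level: "nmem s ''level'' 0 = a"
  shows "runs copy_level s (2 ^ m * 4 + 2) (\<lambda>s'. same_below (a + 2 ^ m) s s' \<and>
    (\<forall>x<2 ^ m. choice_from s' (a + 2 ^ m) x = 0 \<and>
      best_from s' (a + 2 ^ m) x = best_from s a x + rmem s ''cost'' 0))"
proof -
  note [simp] = layoutD[OF layout]
  define I where "I n s' \<longleftrightarrow> same_below (a + 2 ^ m) s s' \<and>
    (\<forall>x<n. choice_from s' (a + 2 ^ m) x = 0 \<and>
      best_from s' (a + 2 ^ m) x = best_from s a x + rmem s ''cost'' 0)" for n and s' :: state
  show ?thesis
    unfolding copy_level_def
  proof (induct rule: runs_For[where n = "2 ^ m" and I = I and B = 2])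
    case (step n s')
    note [simp] = frameD[OF step(2), simplified] step(3) level
    show ?case
      using step(1,4) by (auto simp: I_def same_below_def less_Suc_eq)
  qed (simp_all add: I_def same_below_def frameD)
qed

text \<open>
  Here \<open>u\<close> is the previous level, \<open>g\<close> the cost of a last class, \<open>r\<close> the level under construction
  with choices \<open>d\<close>, and \<open>K\<close> the set of splits tried so far.
\<close>

definition relaxed ::
  "nat \<Rightarrow> (nat set \<Rightarrow> rat) \<Rightarrow> (nat set \<Rightarrow> rat) \<Rightarrow> (nat set \<times> nat set) set \<Rightarrow>
    (nat \<Rightarrow> rat) \<Rightarrow> (nat \<Rightarrow> nat) \<Rightarrow> bool" where
  "relaxed m u g K r d \<longleftrightarrow>
    (\<forall>x<2 ^ m. set_decode (d x) \<subseteq> set_decode x \<and>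
      r x = u (set_decode x - set_decode (d x)) + g (set_decode (d x))) \<and>
    (\<forall>(A, B)\<in>K. r (set_encode (A \<union> B)) \<le> u A + g B)"

lemma disjoint_pairs_imp_add_less_power:
  assumes "(set_decode a, set_decode b) \<in> disjoint_pairs {..<m}"
  shows "a + b < 2 ^ m"
proof -
  have "set_decode (a + b) \<subseteq> set_decode (2 ^ m - 1)"
    using assms set_decode_add[of a b] unfolding set_decode_power_minus_1
    by (simp add: disjoint_pairs_def)
  then have "a + b \<le> 2 ^ m - 1"
    by (rule subset_decode_imp_le)
  then show ?thesis
    by (simp add: le_less_trans)
qed

lemma relaxed_insert_keep:
  assumes "relaxed m u g K r d" and "set_decode a \<inter> set_decode b = {}"
    and "r (a + b) \<le> u (set_decode a) + g (set_decode b)"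
  shows "relaxed m u g (insert (set_decode a, set_decode b) K) r d"
  using assms set_decode_inverse[of "a + b"] by (simp add: relaxed_def set_decode_add)

lemma relaxed_insert_update:
  assumes relaxed: "relaxed m u g K r d" and disj: "set_decode a \<inter> set_decode b = {}"
    and new_value: "v = u (set_decode a) + g (set_decode b)" and less: "v < r (a + b)"
  shows "relaxed m u g (insert (set_decode a, set_decode b) K) (r(a + b := v)) (d(a + b := b))"
proof -
  let ?r = "r(a + b := v)" and ?d = "d(a + b := b)"
  note Un = set_decode_add[OF disj]
  have "set_decode (a + b) - set_decode b = set_decode a"
    using disj Un by auto
  then have "set_decode (?d x) \<subseteq> set_decode x \<and>
      ?r x = u (set_decode x - set_decode (?d x)) + g (set_decode (?d x))" if "x < 2 ^ m" for x
    using relaxed Un new_value that by (cases "x = a + b") (simp_all add: relaxed_def)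
  moreover have "?r (set_encode (A \<union> B)) \<le> u A + g B"
    if "(A, B) \<in> insert (set_decode a, set_decode b) K" for A B
  proof (cases "(A, B) \<in> K")
    case True
    have "?r x \<le> r x" for x
      using less by simp
    also have "r (set_encode (A \<union> B)) \<le> u A + g B"
      using relaxed True by (auto simp: relaxed_def)
    finally show ?thesis .
  next
    case False
    then show ?thesis
      using that new_value set_decode_inverse[of "a + b"] by (simp add: Un)
  qed
  ultimately show ?thesis
    by (auto simp: relaxed_def simp del: fun_upd_apply)
qed

lemma relaxed_disjoint_pairs_imp_optimal:
  assumes "relaxed m (min_cost g i) (g (Suc i)) (disjoint_pairs {..<m}) r d"
  shows "subset_table r m (min_cost g (Suc i))"
    and "x < 2 ^ m \<Longrightarrow> optimal_class g i (set_decode x) (set_decode (d x))"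
proof -
  have opt: "r x = min_cost g (Suc i) (set_decode x)" if x: "x < 2 ^ m" for x
    unfolding min_cost.simps
  proof (rule Min_eqI[symmetric])
    fix v assume "v \<in> (\<lambda>B. min_cost g i (set_decode x - B) + g (Suc i) B) ` Pow (set_decode x)"
    then obtain B where B: "B \<subseteq> set_decode x" "v = min_cost g i (set_decode x - B) + g (Suc i) B"
      by auto
    then have "(set_decode x - B, B) \<in> disjoint_pairs {..<m}"
      using set_decode_subset_lessThan[OF x] by (auto simp: disjoint_pairs_def)
    then have "r (set_encode (set_decode x - B \<union> B)) \<le> v"
      using assms B(2) by (auto simp: relaxed_def)
    then show "r x \<le> v"
      using B(1) by (simp add: Un_absorb2)
  qed (use assms x in \<open>auto simp: relaxed_def\<close>)
  then show "subset_table r m (min_cost g (Suc i))"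
    by (simp add: subset_table_def)
  show "optimal_class g i (set_decode x) (set_decode (d x))" if "x < 2 ^ m"
    using assms opt[OF that] that by (simp add: optimal_class_def relaxed_def)
qed

abbreviation source_cell :: nexp where
  "source_cell \<equiv> NPlus (var ''level'') (NRead ''rest'' (var ''l''))"

abbreviation target_cell :: nexp where
  "target_cell \<equiv>
    NPlus next_level (NPlus (NRead ''rest'' (var ''l'')) (NRead ''class'' (var ''l'')))"

abbreviation candidate :: rexp where
  "candidate \<equiv> RPlus (RRead ''best'' source_cell) (RRead ''cost'' (NRead ''class'' (var ''l'')))"

definition improve_level :: com where
  "improve_level = For ''l'' (var ''pairs'')
    (If (RLess candidate (RRead ''best'' target_cell))
      (RWrite ''best'' target_cell candidate ;;
       NWrite ''choice'' target_cell (NRead ''class'' (var ''l'')))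
      Skip)"

lemma writes_improve_level [simp]:
  "nwrites improve_level = {''l'', ''choice''}" "rwrites improve_level = {''best''}"
  by (auto simp: improve_level_def)

lemma runs_improve_level:
  assumes layout: "layout m c s" and level: "nmem s ''level'' 0 = a" and pairs: "lists_pairs m s"
    and best: "subset_table (best_from s a) m u" and cost: "subset_table (rmem s ''cost'') m g"
    and init: "relaxed m u g {} (best_from s (a + 2 ^ m)) (choice_from s (a + 2 ^ m))"
  shows "runs improve_level s (3 ^ m * 5 + 2) (\<lambda>s'. same_below (a + 2 ^ m) s s' \<and>
    relaxed m u g (disjoint_pairs {..<m}) (best_from s' (a + 2 ^ m)) (choice_from s' (a + 2 ^ m)))"
proof -
  note [simp] = layoutD[OF layout]
  define I where "I n s' \<longleftrightarrow> same_below (a + 2 ^ m) s s' \<and>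
    relaxed m u g (set_pair s ` {..<n}) (best_from s' (a + 2 ^ m)) (choice_from s' (a + 2 ^ m))"
    for n and s' :: state
  show ?thesis
    unfolding improve_level_def
  proof (induct rule: runs_For[where n = "3 ^ m" and I = I and B = 3])
    case (step l s')
    note [simp] = frameD[OF step(2), simplified] step(3) level
    define z y where "z = nmem s ''rest'' l" and "y = nmem s ''class'' l"
    define v where "v = best_from s a z + rmem s ''cost'' y"
    have set_pair: "set_pair s l = (set_decode z, set_decode y)"
      by (simp add: set_pair_def code_pair_def z_def y_def)
    then have pair: "(set_decode z, set_decode y) \<in> disjoint_pairs {..<m}"
      using pairs step(1) by (metis imageI lessThan_iff lists_pairs_def)
    then have disj: "set_decode z \<inter> set_decode y = {}"
      by (simp add: disjoint_pairs_def)
    have same: "same_below (a + 2 ^ m) s s'"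
      and relaxed: "relaxed m u g (set_pair s ` {..<l})
        (best_from s' (a + 2 ^ m)) (choice_from s' (a + 2 ^ m))"
      using step(4) by (simp_all add: I_def)
    have "z < 2 ^ m" "y < 2 ^ m"
      using disjoint_pairs_imp_add_less_power[OF pair] by simp_all
    then have new_value: "v = u (set_decode z) + g (set_decode y)"
      and "best_from s' a z = best_from s a z"
      using best cost same by (simp_all add: v_def subset_table_def same_below_def)
    show ?case
      using relaxed_insert_keep[OF relaxed disj] relaxed_insert_update[OF relaxed disj new_value]
        same new_value \<open>best_from s' a z = best_from s a z\<close>
      by (auto simp: I_def same_below_def set_pair lessThan_Suc fun_upd_def not_less
          simp flip: z_def y_def v_def)
  next
    case (post s')
    then show ?case
      using pairs by (simp add: I_def lists_pairs_def)
  qed (use pairs init in \<open>simp_all add: I_def same_below_def frameD level lists_pairs_def\<close>)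
qed

definition fill_next_level :: com where
  "fill_next_level = copy_level ;; improve_level"

lemma writes_fill_next_level [simp]:
  "nwrites fill_next_level = {''x'', ''l'', ''choice''}" "rwrites fill_next_level = {''best''}"
  by (auto simp: fill_next_level_def)

lemma runs_fill_next_level:
  assumes layout: "layout m c s" and level: "nmem s ''level'' 0 = a" and pairs: "lists_pairs m s"
    and best: "subset_table (best_from s a) m (min_cost g i)"
    and cost: "subset_table (rmem s ''cost'') m (g (Suc i))"
  shows "runs fill_next_level s (2 ^ m * 4 + 3 ^ m * 5 + 4) (level_filled m g i (a + 2 ^ m) s)"
  unfolding fill_next_level_def
  using runs_copy_level[OF layout level]
proof (induct rule: runs_Seq[where T' = "3 ^ m * 5 + 2"])
  case (rest r)
  note [simp] = frameD[OF rest(1), simplified]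
  have "layout m c r" "lists_pairs m r"
    using layout pairs layout_frame[OF rest(1)] lists_pairs_frame[OF rest(1)] by simp_all
  moreover have "subset_table (best_from r a) m (min_cost g i)"
    using best rest(2) by (simp add: subset_table_def same_below_def)
  moreover have "relaxed m (min_cost g i) (g (Suc i)) {}
      (best_from r (a + 2 ^ m)) (choice_from r (a + 2 ^ m))"
    using best cost rest(2) by (simp add: relaxed_def subset_table_def)
  ultimately have "runs improve_level r (3 ^ m * 5 + 2) (\<lambda>s'. same_below (a + 2 ^ m) r s' \<and>
      relaxed m (min_cost g i) (g (Suc i)) (disjoint_pairs {..<m})
        (best_from s' (a + 2 ^ m)) (choice_from s' (a + 2 ^ m)))"
    using level cost by (intro runs_improve_level[where c = c]) simp_all
  then show ?case
    by (rule runs_mono[OF _ order_refl])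
      (use rest(2) in
        \<open>auto simp: level_filled_def same_below_def dest: relaxed_disjoint_pairs_imp_optimal\<close>)
qed simp

definition prepared :: "nat \<Rightarrow> nat \<Rightarrow> (nat \<Rightarrow> nat \<Rightarrow> rat) \<Rightarrow> state \<Rightarrow> bool" where
  "prepared m c w s \<longleftrightarrow> layout m c s \<and> weight_table m c w s \<and> lists_pairs m s"

definition levels_up_to :: "nat \<Rightarrow> nat \<Rightarrow> (nat \<Rightarrow> nat \<Rightarrow> rat) \<Rightarrow> nat \<Rightarrow> state \<Rightarrow> bool" where
  "levels_up_to m c w i s \<longleftrightarrow> nmem s ''color'' 0 = Suc i \<and> nmem s ''level'' 0 = i * 2 ^ m \<and>
    level_table m (\<lambda>i. class_cost w c (Suc i)) i s"

lemma prepared_frame: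
  assumes "frame P s s'" "prepared m c w s" "''weight'' \<notin> rwrites P"
    "nwrites P \<inter> {''size'', ''c'', ''pow'', ''row'', ''pairs'', ''rest'', ''class''} = {}"
  shows "prepared m c w s'"
proof -
  have "layout m c s'" "lists_pairs m s'"
    using assms layout_frame[OF assms(1)] lists_pairs_frame[OF assms(1)]
    by (auto simp: prepared_def)
  moreover have "weight_table m c w s'"
    using assms(2,3) by (simp add: prepared_def weight_table_def frameD[OF assms(1)])
  ultimately show ?thesis
    by (simp add: prepared_def)
qed

lemma prepared_nwrite [simp]:
  "x \<notin> {''size'', ''c'', ''pow'', ''row'', ''pairs'', ''rest'', ''class''} \<Longrightarrow>
    prepared m c w (nwrite x i n s) \<longleftrightarrow> prepared m c w s"
  by (simp add: prepared_def weight_table_def)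

definition add_level :: com where
  "add_level = assign ''color'' (NPlus (var ''color'') (NConst 1)) ;;
    class_costs ;; fill_next_level ;; assign ''level'' next_level"

lemma writes_add_level [simp]:
  "nwrites add_level = {''color'', ''j'', ''l'', ''y'', ''x'', ''choice'', ''level''}"
  "rwrites add_level = {''cost'', ''nbr'', ''best''}"
  by (auto simp: add_level_def)

definition add_level_time :: "nat \<Rightarrow> nat" where
  "add_level_time m = class_costs_time m + (2 ^ m * 4 + 3 ^ m * 5 + 6)"

lemma runs_add_level:
  assumes prepared: "prepared m c w s" and levels: "levels_up_to m c w i s" and "Suc i < c"
  shows "runs add_level s (add_level_time m) (levels_up_to m c w (Suc i))"
proof -
  let ?g = "\<lambda>i. class_cost w c (Suc i)" and ?a = "i * 2 ^ m"
  define s0 where "s0 = nwrite ''color'' 0 (Suc (Suc i)) s"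
  have prepared0: "prepared m c w s0"
    using prepared by (simp add: s0_def)
  then have "runs class_costs s0 (class_costs_time m)
      (\<lambda>s'. subset_table (rmem s' ''cost'') m (?g (Suc i)))"
    using \<open>Suc i < c\<close> by (intro runs_class_costs) (simp_all add: prepared_def s0_def)
  then have "runs (class_costs ;; fill_next_level ;; assign ''level'' next_level) s0
    (add_level_time m - 1) (levels_up_to m c w (Suc i))"
  proof (induct rule: runs_Seq[where T' = "2 ^ m * 4 + 3 ^ m * 5 + 5"])
    case costs: (rest s1)
    note [simp] = frameD[OF costs(1), simplified]
    have prepared1: "prepared m c w s1"
      using prepared0 by (rule prepared_frame[OF costs(1)]) simp_all
    have level1: "nmem s1 ''level'' 0 = ?a" and table1: "level_table m ?g i s1"
      using levels by (simp_all add: levels_up_to_def level_table_def s0_def)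
    with prepared1 have "runs fill_next_level s1 (2 ^ m * 4 + 3 ^ m * 5 + 4)
        (level_filled m ?g i (?a + 2 ^ m) s1)"
      using costs(2)
      by (intro runs_fill_next_level[where c = c]) (simp_all add: prepared_def level_table_def)
    then show ?case
    proof (induct rule: runs_Seq[where T' = 1])
      case filled: (rest s2)
      note [simp] = frameD[OF filled(1), simplified]
      have "level_table m ?g (Suc i) s2"
        using filled(2) by (intro level_table_Suc[OF table1]) (simp add: add.commute)
      then show ?case
        using level1 prepared0
        by (simp add: levels_up_to_def level_table_def s0_def prepared_def layout_def)
    qed simp
  qed (simp add: add_level_time_def)
  then show ?thesis
    using levels by (simp add: add_level_def s0_def levels_up_to_def add_level_time_def)
qed

definition add_levels :: com where
  "add_levels = For ''i'' (NMinus (var ''c'') (NConst 1)) add_level"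

lemma writes_add_levels [simp]:
  "nwrites add_levels = {''i'', ''color'', ''j'', ''l'', ''y'', ''x'', ''choice'', ''level''}"
  "rwrites add_levels = {''cost'', ''nbr'', ''best''}"
  by (auto simp: add_levels_def)

lemma runs_add_levels:
  assumes prepared: "prepared m c w s" and levels: "levels_up_to m c w 0 s"
  shows "runs add_levels s ((c - 1) * (add_level_time m + 2) + 2) (levels_up_to m c w (c - 1))"
  unfolding add_levels_def
proof (induct rule: runs_For[where n = "c - 1" and I = "levels_up_to m c w"
      and B = "add_level_time m"])
  case (bound s')
  then show ?case
    using prepared by (simp add: frameD prepared_def layout_def)
next
  case init
  show ?case
    using levels by (simp add: levels_up_to_def level_table_def)
next
  case (step i s')
  have "prepared m c w s'"
    using prepared by (rule prepared_frame[OF step(2)]) simp_all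
  then have "runs add_level s' (add_level_time m) (levels_up_to m c w (Suc i))"
    using step(1,4) by (intro runs_add_level) simp_all
  then show ?case
    by (rule runs_mono) (simp_all add: levels_up_to_def level_table_def)
qed simp_all

definition compute_levels :: com where
  "compute_levels = assign ''color'' (NConst 1) ;; assign ''level'' (NConst 0) ;;
    class_costs ;; first_level ;; add_levels"

lemma writes_compute_levels [simp]:
  "nwrites compute_levels = {''i'', ''color'', ''j'', ''l'', ''y'', ''x'', ''choice'', ''level''}"
  "rwrites compute_levels = {''cost'', ''nbr'', ''best''}"
  by (auto simp: compute_levels_def)

definition compute_levels_time :: "nat \<Rightarrow> nat \<Rightarrow> nat" where
  "compute_levels_time m c =
    class_costs_time m + (2 ^ m * 3 + 2 + ((c - 1) * (add_level_time m + 2) + 2)) + 2"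

lemma runs_compute_levels:
  assumes prepared: "prepared m c w s" and "1 \<le> c"
  shows "runs compute_levels s (compute_levels_time m c) (levels_up_to m c w (c - 1))"
proof -
  define s0 where "s0 = nwrite ''level'' 0 0 (nwrite ''color'' 0 1 s)"
  have prepared0: "prepared m c w s0"
    using prepared by (simp add: s0_def)
  then have "runs class_costs s0 (class_costs_time m)
      (\<lambda>s'. subset_table (rmem s' ''cost'') m (class_cost w c 1))"
    using \<open>1 \<le> c\<close> by (intro runs_class_costs) (simp_all add: prepared_def s0_def)
  then have "runs (class_costs ;; first_level ;; add_levels) s0
    (compute_levels_time m c - 2) (levels_up_to m c w (c - 1))"
  proof (induct rule: runs_Seq[where T' = "2 ^ m * 3 + 2 + ((c - 1) * (add_level_time m + 2) + 2)"])
    case costs: (rest s1)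
    have prepared1: "prepared m c w s1"
      using prepared0 by (rule prepared_frame[OF costs(1)]) simp_all
    then have "runs first_level s1 (2 ^ m * 3 + 2) (level_table m (\<lambda>i. class_cost w c (Suc i)) 0)"
      using costs(2) by (intro runs_first_level[where c = c]) (simp_all add: prepared_def)
    then show ?case
    proof (induct rule: runs_Seq[where T' = "(c - 1) * (add_level_time m + 2) + 2"])
      case first: (rest s2)
      have "prepared m c w s2"
        using prepared1 by (rule prepared_frame[OF first(1)]) simp_all
      moreover have "levels_up_to m c w 0 s2"
        using frameD[OF costs(1)] frameD[OF first(1)] first(2)
        by (simp add: levels_up_to_def s0_def)
      ultimately show ?case
        by (rule runs_add_levels)
    qed simp
  qed (simp add: compute_levels_time_def)
  then show ?thesis
    by (simp add: compute_levels_def s0_def compute_levels_time_def)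
qed

section \<open>Tracing back an optimal coloring\<close>

lemma mod_power_Suc_eq_set_decode:
  "x mod 2 ^ Suc j = (if j \<in> set_decode x then 2 ^ j else 0) + x mod 2 ^ j"
proof -
  have "x mod 2 ^ Suc j = 2 ^ j * (x div 2 ^ j mod 2) + x mod 2 ^ j"
    unfolding power_Suc2 by (rule mod_mult2_eq)
  then show ?thesis
    by (simp add: set_decode_def odd_iff_mod_2_eq_one)
qed

abbreviation top_index :: nexp where
  "top_index \<equiv> NMinus (NMinus card_S (NConst 1)) (var ''l'')"

definition paint :: com where
  "paint = For ''l'' card_S
    (If (NLess (var ''bits'') (NRead ''pow'' top_index)) Skip
      (NWrite ''col'' (NRead ''S'' top_index) (var ''color'') ;;
       assign ''bits'' (NMinus (var ''bits'') (NRead ''pow'' top_index))))"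

lemma writes_paint [simp]: "nwrites paint = {''l'', ''col'', ''bits''}" "rwrites paint = {}"
  by (auto simp: paint_def)

definition painted :: "nat \<Rightarrow> nat set \<Rightarrow> nat \<Rightarrow> state \<Rightarrow> state \<Rightarrow> bool" where
  "painted m A q s s' \<longleftrightarrow>
    (\<forall>j<m. nmem s' ''col'' (nmem s ''S'' j) = (if j \<in> A then q else vertex_color s j)) \<and>
    same_outside_S m s s'"

lemma runs_paint:
  assumes layout: "layout m c s" and inj: "inj_on (nmem s ''S'') {..<m}"
    and bits: "nmem s ''bits'' 0 = b" "b < 2 ^ m" and color: "nmem s ''color'' 0 = q"
  shows "runs paint s (m * 5 + 2) (painted m (set_decode b) q s)"
proof -
  note [simp] = layoutD[OF layout]
  define I where "I n s' \<longleftrightarrow> nmem s' ''bits'' 0 = b mod 2 ^ (m - n) \<and>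
    painted m (set_decode b \<inter> {m - n..}) q s s'" for n and s' :: state
  show ?thesis
    unfolding paint_def
  proof (induct rule: runs_For[where n = m and I = I and B = 3])
    case (step n s')
    note [simp] = frameD[OF step(2), simplified] step(3) color
    define j where "j = m - 1 - n"
    have j: "j < m" "m - n = Suc j" "m - Suc n = j" "m - Suc 0 - n = j"
      using step(1) by (auto simp: j_def)
    have top: "Suc j \<le> i \<longleftrightarrow> j \<le> i \<and> i \<noteq> j" for i
      by auto
    have same_vertex: "nmem s ''S'' i = nmem s ''S'' j \<longleftrightarrow> i = j" if "i < m" for i
      using inj_on_eq_iff[OF inj] j(1) that by simp
    have "b mod 2 ^ j < 2 ^ j"
      by simp
    then show ?case
      using step(4) j same_vertex mod_power_Suc_eq_set_decode[of b j]
      by (auto simp: I_def painted_def same_outside_S_def top)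
  qed (use bits in \<open>auto simp: I_def painted_def same_outside_S_def frameD\<close>)
qed

definition trace_step :: com where
  "trace_step =
    assign ''bits'' (NRead ''choice'' (NPlus (var ''level'') (var ''todo''))) ;;
    assign ''todo'' (NMinus (var ''todo'') (var ''bits'')) ;;
    assign ''level'' (NMinus (var ''level'') (NRead ''pow'' card_S)) ;;
    paint ;;
    assign ''color'' (NMinus (var ''color'') (NConst 1))"

lemma writes_trace_step [simp]:
  "nwrites trace_step = {''bits'', ''todo'', ''level'', ''l'', ''col'', ''color''}"
  "rwrites trace_step = {}"
  by (auto simp: trace_step_def)

text \<open>
  The vertices with indices in \<open>todo\<close> still need colors up to \<open>Suc k\<close>; every optimal way of coloring
  them completes the colors chosen so far to an optimal coloring.
\<close>

definition traced :: "nat \<Rightarrow> nat \<Rightarrow> (nat \<Rightarrow> nat set \<Rightarrow> rat) \<Rightarrow> nat \<Rightarrow> state \<Rightarrow> bool" where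
  "traced m c g k s \<longleftrightarrow> nmem s ''color'' 0 = Suc k \<and> nmem s ''level'' 0 = k * 2 ^ m \<and>
    nmem s ''todo'' 0 < 2 ^ m \<and>
    (let A = set_decode (nmem s ''todo'' 0) in
      (\<forall>j<m. j \<notin> A \<longrightarrow> vertex_color s j \<in> {1..c}) \<and>
      (\<forall>f. optimal_partition g k A f \<longrightarrow>
        optimal_partition g (c - 1) {..<m} (\<lambda>j. if j \<in> A then f j else vertex_color s j - 1)))"

lemma traced_step:
  assumes traced: "traced m c g (Suc k) s" and table: "level_table m g (c - 1) s" and "Suc k < c"
    and choice: "b = choice_from s (Suc k * 2 ^ m) (nmem s ''todo'' 0)"
    and scalars: "nmem s' ''color'' 0 = Suc k" "nmem s' ''level'' 0 = k * 2 ^ m"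
      "nmem s' ''todo'' 0 = nmem s ''todo'' 0 - b"
    and same_S: "nmem s' ''S'' = nmem s ''S''"
    and painted: "painted m (set_decode b) (Suc (Suc k)) s s'"
  shows "traced m c g k s'"
proof -
  let ?A = "set_decode (nmem s ''todo'' 0)" and ?B = "set_decode b"
  have todo: "nmem s ''todo'' 0 < 2 ^ m"
    and colors: "\<And>j. j < m \<Longrightarrow> j \<notin> ?A \<Longrightarrow> vertex_color s j \<in> {1..c}"
    and completes: "\<And>f. optimal_partition g (Suc k) ?A f \<Longrightarrow>
      optimal_partition g (c - 1) {..<m} (\<lambda>j. if j \<in> ?A then f j else vertex_color s j - 1)"
    using traced by (simp_all add: traced_def Let_def)
  have opt: "optimal_class g k ?A ?B"
    using table todo \<open>Suc k < c\<close> by (simp add: level_table_def choice)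
  then have diff: "set_decode (nmem s' ''todo'' 0) = ?A - ?B"
    unfolding scalars(3) by (intro set_decode_diff) (simp add: optimal_class_def)
  have "vertex_color s' j \<in> {1..c}" if "j < m" "j \<notin> ?A - ?B" for j
    using colors[OF that(1)] painted that \<open>Suc k < c\<close> by (auto simp: painted_def same_S)
  moreover have "optimal_partition g (c - 1) {..<m}
      (\<lambda>j. if j \<in> ?A - ?B then f j else vertex_color s' j - 1)"
    if "optimal_partition g k (?A - ?B) f" for f
  proof -
    let ?f = "\<lambda>j. if j \<in> ?B then Suc k else f j"
    have "?B \<subseteq> ?A"
      using opt by (simp add: optimal_class_def)
    then have eq: "(if j \<in> ?A then ?f j else vertex_color s j - 1) =
        (if j \<in> ?A - ?B then f j else vertex_color s' j - 1)" if "j \<in> {..<m}" for j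
      using painted that by (auto simp: painted_def same_S)
    have "optimal_partition g (c - 1) {..<m} (\<lambda>j. if j \<in> ?A then ?f j else vertex_color s j - 1)"
      using opt that by (intro completes optimal_partition_Suc)
    then show ?thesis
      by (rule optimal_partition_cong[THEN iffD1, OF refl, rotated]) (rule eq)
  qed
  ultimately show ?thesis
    using todo scalars same_S diff by (simp add: traced_def)
qed

lemma runs_trace_step:
  assumes layout: "layout m c s" and inj: "inj_on (nmem s ''S'') {..<m}"
    and table: "level_table m g (c - 1) s" and traced: "traced m c g (Suc k) s" and "Suc k < c"
  shows "runs trace_step s (m * 5 + 6) (\<lambda>s'. traced m c g k s' \<and> same_outside_S m s s')"
proof -
  define t b where "t = nmem s ''todo'' 0" and "b = choice_from s (Suc k * 2 ^ m) t"
  define s0 where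
    "s0 = nwrite ''level'' 0 (k * 2 ^ m) (nwrite ''todo'' 0 (t - b) (nwrite ''bits'' 0 b s))"
  have scalars: "nmem s ''color'' 0 = Suc (Suc k)" "nmem s ''level'' 0 = Suc k * 2 ^ m"
    and t: "t < 2 ^ m"
    using traced by (simp_all add: traced_def t_def)
  have "set_decode b \<subseteq> set_decode t"
    using table t \<open>Suc k < c\<close> by (simp add: level_table_def optimal_class_def b_def)
  then have "b < 2 ^ m"
    using subset_decode_imp_le t le_less_trans by blast
  then have "runs paint s0 (m * 5 + 2) (painted m (set_decode b) (Suc (Suc k)) s0)"
    using layout inj scalars by (intro runs_paint[where c = c]) (simp_all add: s0_def)
  then have "runs (paint ;; assign ''color'' (NMinus (var ''color'') (NConst 1))) s0 (m * 5 + 3)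
      (\<lambda>s'. traced m c g k s' \<and> same_outside_S m s s')"
  proof (induct rule: runs_Seq[where T' = 1])
    case (rest r)
    note [simp] = frameD[OF rest(1), simplified]
    have "traced m c g k (nwrite ''color'' 0 (Suc k) r)"
      by (rule traced_step[OF traced table \<open>Suc k < c\<close> b_def[unfolded t_def]])
        (use rest(2) in \<open>simp_all add: s0_def t_def painted_def same_outside_S_def\<close>)
    then show ?case
      using rest(2) scalars by (simp add: s0_def painted_def same_outside_S_def)
  qed simp
  then show ?thesis
    using scalars layout by (simp add: trace_step_def s0_def b_def t_def layoutD add.commute)
qed

definition trace_steps :: com where
  "trace_steps = For ''i'' (NMinus (var ''c'') (NConst 1)) trace_step"

lemma writes_trace_steps [simp]:
  "nwrites trace_steps = {''i'', ''bits'', ''todo'', ''level'', ''l'', ''col'', ''color''}"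
  "rwrites trace_steps = {}"
  by (auto simp: trace_steps_def)

lemma runs_trace_steps:
  assumes layout: "layout m c s" and inj: "inj_on (nmem s ''S'') {..<m}"
    and table: "level_table m g (c - 1) s" and traced: "traced m c g (c - 1) s"
  shows "runs trace_steps s ((c - 1) * (m * 5 + 8) + 2)
    (\<lambda>s'. traced m c g 0 s' \<and> same_outside_S m s s')"
  unfolding trace_steps_def
proof (induct rule: runs_For[where n = "c - 1" and B = "m * 5 + 6"
      and I = "\<lambda>n s'. traced m c g (c - 1 - n) s' \<and> same_outside_S m s s'"])
  case init
  show ?case
    using traced by (simp add: traced_def same_outside_S_def Let_def cong: if_cong)
next
  case (step n s')
  note [simp] = frameD[OF step(2), simplified]
  define k where "k = c - 1 - Suc n"
  have k: "c - 1 - n = Suc k" "Suc k < c"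
    using step(1) by (auto simp: k_def)
  have "runs trace_step s' (m * 5 + 6) (\<lambda>r. traced m c g k r \<and> same_outside_S m s' r)"
    using layout inj table step(4) k
    by (intro runs_trace_step) (simp_all add: layout_def level_table_def)
  then show ?case
    by (rule runs_mono)
      (use step(4) in \<open>simp_all add: traced_def same_outside_S_def Let_def k_def cong: if_cong\<close>)
qed (use layout in \<open>simp_all add: frameD layoutD\<close>)

definition optimally_colored ::
  "nat \<Rightarrow> nat \<Rightarrow> (nat \<Rightarrow> nat set \<Rightarrow> rat) \<Rightarrow> state \<Rightarrow> state \<Rightarrow> bool" where
  "optimally_colored m c g s s' \<longleftrightarrow> same_outside_S m s s' \<and>
    (\<forall>j<m. nmem s' ''col'' (nmem s ''S'' j) \<in> {1..c}) \<and>
    optimal_partition g (c - 1) {..<m} (\<lambda>j. nmem s' ''col'' (nmem s ''S'' j) - 1)"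

definition paint_rest :: com where
  "paint_rest = assign ''bits'' (var ''todo'') ;; paint"

lemma runs_paint_rest:
  assumes layout: "layout m c s" and inj: "inj_on (nmem s ''S'') {..<m}" and "1 \<le> c"
    and traced: "traced m c g 0 s"
  shows "runs paint_rest s (m * 5 + 3) (optimally_colored m c g s)"
proof -
  define A s0 where "A = set_decode (nmem s ''todo'' 0)"
    and "s0 = nwrite ''bits'' 0 (nmem s ''todo'' 0) s"
  have opt: "optimal_partition g (c - 1) {..<m} (\<lambda>j. if j \<in> A then 0 else vertex_color s j - 1)"
    and colors: "\<forall>j<m. j \<notin> A \<longrightarrow> vertex_color s j \<in> {1..c}"
    using traced optimal_partition_0[of g A] by (auto simp: traced_def Let_def A_def)
  have final: "optimally_colored m c g s s'" if s': "painted m A 1 s0 s'" for s'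
    unfolding optimally_colored_def
  proof (intro conjI)
    have eq: "(if j \<in> A then 0 else vertex_color s j - 1) = nmem s' ''col'' (nmem s ''S'' j) - 1"
      if "j \<in> {..<m}" for j
      using s' that by (simp add: painted_def s0_def)
    show "optimal_partition g (c - 1) {..<m} (\<lambda>j. nmem s' ''col'' (nmem s ''S'' j) - 1)"
      using opt by (rule optimal_partition_cong[THEN iffD1, OF refl, rotated]) (rule eq)
  qed (use s' colors \<open>1 \<le> c\<close> in \<open>auto simp: painted_def same_outside_S_def s0_def\<close>)
  have "runs paint s0 (m * 5 + 2) (painted m A 1 s0)"
    using layout inj traced unfolding A_def
    by (intro runs_paint[where c = c]) (simp_all add: s0_def traced_def)
  then have "runs paint s0 (m * 5 + 2) (optimally_colored m c g s)"
    by (rule runs_mono[OF _ order_refl final])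
  then show ?thesis
    by (simp add: paint_rest_def s0_def)
qed

definition trace_back :: com where
  "trace_back = assign ''todo'' (NMinus (NRead ''pow'' card_S) (NConst 1)) ;;
    trace_steps ;; paint_rest"

definition trace_back_time :: "nat \<Rightarrow> nat \<Rightarrow> nat" where
  "trace_back_time m c = (c - 1) * (m * 5 + 8) + (m * 5 + 6)"

lemma runs_trace_back:
  assumes layout: "layout m c s" and inj: "inj_on (nmem s ''S'') {..<m}" and "1 \<le> c"
    and scalars: "nmem s ''color'' 0 = c" "nmem s ''level'' 0 = (c - 1) * 2 ^ m"
    and table: "level_table m g (c - 1) s"
  shows "runs trace_back s (trace_back_time m c) (optimally_colored m c g s)"
proof -
  define s0 where "s0 = nwrite ''todo'' 0 (2 ^ m - 1) s"
  have "optimal_partition g (c - 1) {..<m} (\<lambda>j. if j < m then f j else q j) \<longleftrightarrow>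
      optimal_partition g (c - 1) {..<m} f" for f q
    by (rule optimal_partition_cong) simp_all
  then have "traced m c g (c - 1) s0"
    using scalars \<open>1 \<le> c\<close> set_decode_power_minus_1[of m] by (simp add: s0_def traced_def)
  then have "runs trace_steps s0 ((c - 1) * (m * 5 + 8) + 2)
      (\<lambda>s'. traced m c g 0 s' \<and> same_outside_S m s0 s')"
    using layout inj table by (intro runs_trace_steps) (simp_all add: s0_def level_table_def)
  then have "runs (trace_steps ;; paint_rest) s0 (trace_back_time m c - 1)
    (optimally_colored m c g s)"
  proof (induct rule: runs_Seq[where T' = "m * 5 + 3"])
    case (rest r)
    note [simp] = frameD[OF rest(1), simplified]
    have "layout m c r"
      using layout layout_frame[OF rest(1)] by (simp add: s0_def)
    then have "runs paint_rest r (m * 5 + 3) (optimally_colored m c g r)"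
      using inj \<open>1 \<le> c\<close> rest(2) by (intro runs_paint_rest) (simp_all add: s0_def)
    then show ?case
      by (rule runs_mono)
        (use rest(2) in \<open>simp_all add: optimally_colored_def same_outside_S_def s0_def\<close>)
  qed (simp add: trace_back_time_def)
  then show ?thesis
    using layout by (simp add: trace_back_def s0_def layoutD trace_back_time_def)
qed

section \<open>The algorithm\<close>

definition optimal_recoloring ::
  "'v set \<Rightarrow> 'v set set \<Rightarrow> ('v set \<Rightarrow> rat) \<Rightarrow> nat \<Rightarrow> ('v \<Rightarrow> nat) \<Rightarrow> 'v set \<Rightarrow> ('v \<Rightarrow> nat) \<Rightarrow> bool" where
  "optimal_recoloring V E \<omega> c \<chi> S \<chi>' \<longleftrightarrow> coloring V c \<chi>' \<and> D_flip V \<chi> \<chi>' \<subseteq> S \<and>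
    (\<forall>\<chi>''. coloring V c \<chi>'' \<and> D_flip V \<chi> \<chi>'' \<subseteq> S \<longrightarrow>
      weight \<omega> (cut_edges E \<chi>'') \<le> weight \<omega> (cut_edges E \<chi>'))"

lemma D_flip_subset_iff: "D_flip V \<chi> \<chi>' \<subseteq> S \<longleftrightarrow> (\<forall>u\<in>V - S. \<chi> u = \<chi>' u)"
  by (auto simp: D_flip_def)

lemma optimal_recoloring_empty:
  assumes "graph V E" "coloring V c \<chi>" "\<And>u. u \<in> V \<Longrightarrow> \<chi>' u = \<chi> u"
  shows "optimal_recoloring V E \<omega> c \<chi> {} \<chi>'"
proof -
  have "weight \<omega> (cut_edges E \<chi>'') \<le> weight \<omega> (cut_edges E \<chi>')"
    if flip: "D_flip V \<chi> \<chi>'' \<subseteq> {}" for \<chi>''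
  proof -
    have "\<chi>'' u = \<chi>' u" if "u \<in> \<Union>E" for u
    proof -
      have "u \<in> V"
        using assms(1) that by (auto simp: graph_def)
      then show ?thesis
        using flip assms(3) unfolding D_flip_subset_iff by simp
    qed
    then have "cut_edges E \<chi>'' = cut_edges E \<chi>'"
      by (rule cut_edges_cong)
    then show ?thesis
      by simp
  qed
  then show ?thesis
    using assms by (auto simp: optimal_recoloring_def D_flip_def coloring_def)
qed

locale encoded_instance =
  fixes V :: "nat set" and E :: "nat set set" and \<omega> :: "nat set \<Rightarrow> rat" and c :: nat
    and \<chi> :: "nat \<Rightarrow> nat" and S :: "nat set" and s :: state
  assumes is_graph: "graph V E" and is_coloring: "coloring V c \<chi>" and S_subset: "S \<subseteq> V"
    and encodes: "encodes s V E \<omega> c \<chi> S"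
begin

abbreviation m :: nat where "m \<equiv> card S"

lemma bij_S: "bij_betw (nmem s ''S'') {..<m} S"
  using encodes by (simp add: encodes_def)

sublocale recoloring V E \<omega> c \<chi> "nmem s ''S''" m
  using is_graph is_coloring S_subset bij_S by unfold_locales (auto simp: bij_betw_def)

lemma image_S: "nmem s ''S'' ` {..<m} = S"
  using bij_S by (simp add: bij_betw_def)

lemma nth_S_in_V: "j < m \<Longrightarrow> nmem s ''S'' j \<in> V"
  using sv_in_V by auto

lemma input_scalars: "nmem s ''size'' 0 = m" "nmem s ''c'' 0 = c"
  using encodes by (simp_all add: encodes_def)

lemma input_coloring: "u \<in> V \<Longrightarrow> nmem s ''col'' u = \<chi> u"
  using encodes by (simp add: encodes_def)

lemma input_degree: "j < m \<Longrightarrow> nmem s ''deg'' (nmem s ''S'' j) = degree E (nmem s ''S'' j)"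
  using encodes nth_S_in_V by (simp add: encodes_def)

lemma input_degree_le: "j < m \<Longrightarrow> degree E (nmem s ''S'' j) \<le> max_degree V E"
  using is_graph by (intro degree_le_max_degree nth_S_in_V) (simp_all add: graph_def)

lemma bij_nth_neighbour:
  "j < m \<Longrightarrow>
    bij_betw (nth_neighbour s j) {..<degree E (nmem s ''S'' j)} (neighbours E (nmem s ''S'' j))"
  using encodes nth_S_in_V by (simp add: encodes_def nth_neighbour_def[abs_def])

lemma nth_weight_eq:
  "j < m \<Longrightarrow> p < degree E (nmem s ''S'' j) \<Longrightarrow>
    nth_weight s j p = \<omega> {nmem s ''S'' j, nth_neighbour s j p}"
  using encodes nth_S_in_V by (simp add: encodes_def nth_weight_def nth_neighbour_def)

lemma nth_neighbour_in_V: "j < m \<Longrightarrow> p < degree E (nmem s ''S'' j) \<Longrightarrow> nth_neighbour s j p \<in> V"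
  using bij_betwE[OF bij_nth_neighbour] neighbours_subset[OF is_graph] by blast

lemma incident_weight_eq_sum_nth:
  assumes "j < m"
  shows "incident_weight j q =
    (\<Sum>p | p < degree E (nmem s ''S'' j) \<and> mark (nth_neighbour s j p) = q. nth_weight s j p)"
proof -
  have "bij_betw (nth_neighbour s j)
      {p. p < degree E (nmem s ''S'' j) \<and> mark (nth_neighbour s j p) = q}
      {u. u \<in> neighbours E (nmem s ''S'' j) \<and> mark u = q}"
    using bij_nth_neighbour[OF assms] by (auto simp: bij_betw_def inj_on_def image_iff)
  then have "incident_weight j q =
      (\<Sum>p | p < degree E (nmem s ''S'' j) \<and> mark (nth_neighbour s j p) = q.
        \<omega> {nmem s ''S'' j, nth_neighbour s j p})"
    unfolding incident_weight_def by (rule sum.reindex_bij_betw[symmetric])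
  also have "\<dots> =
      (\<Sum>p | p < degree E (nmem s ''S'' j) \<and> mark (nth_neighbour s j p) = q. nth_weight s j p)"
    using nth_weight_eq[OF assms] by (intro sum.cong) auto
  finally show ?thesis .
qed

end

lemma (in encoded_instance) runs_collect_incident_weights:
  assumes layout: "layout m c s'" and col: "\<And>u. u \<in> V \<Longrightarrow> nmem s' ''col'' u = mark u"
    and input: "\<And>x. x \<in> {''deg'', ''S'', ''adj'', ''start''} \<Longrightarrow> nmem s' x = nmem s x"
      "rmem s' = rmem s"
  shows "runs collect_weights s' (m * (max_degree V E * 3 + 4) + 2)
    (weight_table m c incident_weight)"
proof -
  note [simp] = input
  have nth: "nth_neighbour s' = nth_neighbour s" "nth_weight s' = nth_weight s"
    by (simp_all add: nth_neighbour_def[abs_def] nth_weight_def[abs_def])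
  have "rmem s ''weight'' = (\<lambda>_. 0)"
    using encodes by (simp add: encodes_def)
  then have "runs collect_weights s' (m * (max_degree V E * 3 + 4) + 2) (weight_table m c
      (\<lambda>j q. \<Sum>p | p < degree E (nmem s ''S'' j) \<and> nmem s' ''col'' (nth_neighbour s' j p) = q.
        nth_weight s' j p))"
    using input_degree_le nth_neighbour_in_V col mark_less
    by (intro runs_collect_weights[OF layout]) (simp_all add: input_degree nth)
  then show ?thesis
    by (rule runs_mono[OF _ order_refl])
      (use col nth_neighbour_in_V in
        \<open>simp add: weight_table_def incident_weight_eq_sum_nth nth cong: conj_cong\<close>)
qed

definition prepare :: com where
  "prepare = init_layout ;; mark_vertices ;; list_pairs ;; collect_weights"

lemma writes_prepare [simp]:
  "nwrites prepare =
    {''pow'', ''row'', ''j'', ''col'', ''p'', ''pairs'', ''l'', ''rest'', ''class''}"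
  "rwrites prepare = {''weight''}"
  by (auto simp: prepare_def)

definition prepare_time :: "nat \<Rightarrow> nat \<Rightarrow> nat" where
  "prepare_time m d =
    (m * 4 + 4) + ((m * 3 + 2) + ((m * (3 ^ m * 6 + 5) + 5) + (m * (d * 3 + 4) + 2)))"

lemma (in encoded_instance) runs_prepare:
  "runs prepare s (prepare_time m (max_degree V E))
    (\<lambda>s'. prepared m c incident_weight s' \<and> same_outside_S m s s')"
  unfolding prepare_def prepare_time_def
  using runs_init_layout[OF input_scalars]
proof (induct rule: runs_Seq[where
      T' = "(m * 3 + 2) + ((m * (3 ^ m * 6 + 5) + 5) + (m * (max_degree V E * 3 + 4) + 2))"])
  case init: (rest s1)
  have "inj_on (nmem s1 ''S'') {..<m}"
    using inj_sv by (simp add: frameD[OF init(1)])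
  from runs_mark_vertices[OF init(2) this] show ?case
  proof (induct rule: runs_Seq[where
        T' = "(m * (3 ^ m * 6 + 5) + 5) + (m * (max_degree V E * 3 + 4) + 2)"])
    case mark: (rest s2)
    have layout: "layout m c s2"
      using init(2) by (rule layout_frame[OF mark(1)]) simp
    from runs_list_pairs[OF this] show ?case
    proof (induct rule: runs_Seq[where T' = "m * (max_degree V E * 3 + 4) + 2"])
      case list: (rest s3)
      note [simp] = frameD[OF init(1), simplified] frameD[OF mark(1), simplified]
        frameD[OF list(1), simplified]
      have layout3: "layout m c s3"
        using layout by (rule layout_frame[OF list(1)]) simp
      moreover have "nmem s3 ''col'' u = mark u" if "u \<in> V" for u
        using mark(2) input_coloring[OF that]
        by (cases "u \<in> nmem s ''S'' ` {..<m}") (auto simp: same_outside_S_def)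
      ultimately have "runs collect_weights s3 (m * (max_degree V E * 3 + 4) + 2)
          (weight_table m c incident_weight)"
        by (intro runs_collect_incident_weights) auto
      then show ?case
      proof (rule runs_mono[OF _ order_refl])
        fix s4 assume collect: "frame collect_weights s3 s4" "weight_table m c incident_weight s4"
        have "layout m c s4" "lists_pairs m s4"
          using layout3 list(2) layout_frame[OF collect(1)] lists_pairs_frame[OF collect(1)]
          by simp_all
        then show "prepared m c incident_weight s4 \<and> same_outside_S m s s4"
          using collect(2) mark(2)
          by (simp add: prepared_def same_outside_S_def frameD[OF collect(1)])
      qed
    qed simp
  qed simp
qed simp

definition solve :: com where
  "solve = If (NLess (NConst 0) card_S) (prepare ;; compute_levels ;; trace_back) Skip"

definition solve_time :: "nat \<Rightarrow> nat \<Rightarrow> nat \<Rightarrow> nat" where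
  "solve_time m c d = prepare_time m d + (compute_levels_time m c + trace_back_time m c) + 1"

lemma (in encoded_instance) optimal_partition_imp_optimal_recoloring:
  assumes same: "\<And>u. u \<in> V - S \<Longrightarrow> \<chi>' u = \<chi> u"
    and colors: "\<And>j. j < m \<Longrightarrow> \<chi>' (nmem s ''S'' j) \<in> {1..c}"
    and opt: "optimal_partition color_cost (c - 1) {..<m} (\<lambda>j. \<chi>' (nmem s ''S'' j) - 1)"
  shows "optimal_recoloring V E \<omega> c \<chi> S \<chi>'"
proof -
  have "\<chi>' u \<in> {1..c}" if "u \<in> V" for u
  proof (cases "u \<in> S")
    case True
    then obtain j where "j < m" "u = nmem s ''S'' j"
      using image_S by blast
    then show ?thesis
      using colors by simp
  next
    case False
    then show ?thesis
      using same is_coloring that by (simp add: coloring_def)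
  qed
  then have col: "coloring V c \<chi>'"
    by (simp add: coloring_def)
  moreover have "D_flip V \<chi> \<chi>' \<subseteq> S"
    using same by (simp add: D_flip_subset_iff)
  moreover have "weight \<omega> (cut_edges E \<chi>'') \<le> weight \<omega> (cut_edges E \<chi>')"
    if "coloring V c \<chi>''" "D_flip V \<chi> \<chi>'' \<subseteq> S" for \<chi>''
    using that same
    by (intro optimal_partition_imp_weight_cut_edges_le[OF col _ opt])
      (simp_all add: image_S D_flip_subset_iff)
  ultimately show ?thesis
    by (simp add: optimal_recoloring_def)
qed

lemma (in encoded_instance) runs_solve:
  assumes "1 \<le> m" "1 \<le> c"
  shows "runs solve s (solve_time m c (max_degree V E))
    (\<lambda>s'. optimal_recoloring V E \<omega> c \<chi> S (output_coloring s'))"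
proof -
  from runs_prepare have "runs (prepare ;; compute_levels ;; trace_back) s
    (solve_time m c (max_degree V E) - 1)
    (\<lambda>s'. optimal_recoloring V E \<omega> c \<chi> S (output_coloring s'))"
  proof (induct rule: runs_Seq[where T' = "compute_levels_time m c + trace_back_time m c"])
    case prepare: (rest s1)
    have "runs compute_levels s1 (compute_levels_time m c)
        (levels_up_to m c incident_weight (c - 1))"
      using prepare(2) \<open>1 \<le> c\<close> by (intro runs_compute_levels) simp_all
    then show ?case
    proof (induct rule: runs_Seq[where T' = "trace_back_time m c"])
      case levels: (rest s2)
      note [simp] = frameD[OF prepare(1), simplified] frameD[OF levels(1), simplified]
      have "runs trace_back s2 (trace_back_time m c) (optimally_colored m c color_cost s2)"
        using prepare(2) levels(2) inj_sv \<open>1 \<le> c\<close>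
        by (intro runs_trace_back) (simp_all add: prepared_def levels_up_to_def layout_def)
      then show ?case
      proof (rule runs_mono[OF _ order_refl])
        fix s3 assume "optimally_colored m c color_cost s2 s3"
        then show "optimal_recoloring V E \<omega> c \<chi> S (output_coloring s3)"
          using prepare(2) input_coloring
          by (intro optimal_partition_imp_optimal_recoloring)
            (simp_all add: output_coloring_def optimally_colored_def same_outside_S_def image_S)
      qed
    qed simp
  qed (simp add: solve_time_def)
  then show ?thesis
    using input_scalars(1) \<open>1 \<le> m\<close> by (simp add: solve_def solve_time_def)
qed

lemma add_level_time_le:
  assumes "1 \<le> m"
  shows "add_level_time m + 2 \<le> 37 * (3 ^ m * m\<^sup>2)"
proof -
  define b where "b = 3 ^ m * m\<^sup>2"
  have monomial: "x * y \<le> b" if "x \<le> 3 ^ m" "y \<le> m\<^sup>2" for x y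
    unfolding b_def using that by (rule mult_le_mono)
  have pow: "(2::nat) ^ m \<le> 3 ^ m" "(1::nat) \<le> 3 ^ m" "m \<le> m\<^sup>2" "1 \<le> m\<^sup>2"
    using assms by (auto intro: power_mono simp: power2_eq_square)
  have "1 \<le> b" "m \<le> b" "m * m \<le> b" "2 ^ m \<le> b" "m * 2 ^ m \<le> b" "m * (m * 2 ^ m) \<le> b" "3 ^ m \<le> b"
    using monomial[of 1 1] monomial[of 1 m] monomial[of 1 "m\<^sup>2"] monomial[of "2 ^ m" 1]
      monomial[of "2 ^ m" m] monomial[of "2 ^ m" "m\<^sup>2"] monomial[of "3 ^ m" 1] pow
    by (simp_all add: power2_eq_square ac_simps)
  then have "add_level_time m + 2 \<le> 37 * b"
    by (simp add: add_level_time_def class_costs_time_def add_vertex_costs_time_def algebra_simps)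
  then show ?thesis
    by (simp add: b_def)
qed

lemma compute_levels_time_le:
  assumes "1 \<le> m" "1 \<le> c"
  shows "compute_levels_time m c \<le> 37 * (3 ^ m * c * m\<^sup>2)"
proof -
  have "compute_levels_time m c \<le> (c - 1) * (add_level_time m + 2) + (add_level_time m + 2)"
    by (simp add: compute_levels_time_def add_level_time_def)
  also have "\<dots> = c * (add_level_time m + 2)"
    using assms(2) by (simp add: mult_eq_if)
  also have "\<dots> \<le> c * (37 * (3 ^ m * m\<^sup>2))"
    using add_level_time_le[OF assms(1)] by (rule mult_le_mono2)
  finally show ?thesis
    by (simp add: ac_simps)
qed

lemma solve_time_le:
  assumes "1 \<le> m" "1 \<le> c"
  shows "solve_time m c d \<le> 100 * (3 ^ m * c * m\<^sup>2 + m * d)"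
proof -
  define a where "a = 3 ^ m * c * m\<^sup>2"
  have monomial: "x * y * z \<le> a" if "x \<le> 3 ^ m" "y \<le> c" "z \<le> m\<^sup>2" for x y z
    unfolding a_def using that by (intro mult_le_mono)
  have pow: "(1::nat) \<le> 3 ^ m" "m \<le> m\<^sup>2" "1 \<le> m\<^sup>2"
    using assms(1) by (simp_all add: power2_eq_square)
  have monomials: "1 \<le> a" "m \<le> a" "m * 3 ^ m \<le> a" "c \<le> a" "c * m \<le> a"
    using monomial[of 1 1 1] monomial[of 1 1 m] monomial[of "3 ^ m" 1 m] monomial[of 1 c 1]
      monomial[of 1 c m] pow assms(2) by (simp_all add: ac_simps)
  have "prepare_time m d \<le> 35 * a + 3 * (m * d)"
    using monomials by (simp add: prepare_time_def algebra_simps)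
  moreover have "compute_levels_time m c \<le> 37 * a"
    using compute_levels_time_le[OF assms] by (simp add: a_def)
  moreover have "trace_back_time m c \<le> c * (m * 5 + 8) + (m * 5 + 6)"
    unfolding trace_back_time_def by (intro add_mono mult_le_mono1) simp_all
  then have "trace_back_time m c \<le> 24 * a"
    using monomials by (simp add: algebra_simps)
  ultimately have "solve_time m c d \<le> 100 * a + 100 * (m * d)"
    using monomials(1) by (simp add: solve_time_def)
  then show ?thesis
    by (simp add: a_def)
qed

lemma (in encoded_instance) runs_solve_bounded:
  assumes "m \<le> k"
  shows "runs solve s (100 * max 1 (3 ^ k * c * k\<^sup>2 + k * max_degree V E))
    (\<lambda>s'. optimal_recoloring V E \<omega> c \<chi> S (output_coloring s'))"
proof (cases "S = {}")
  case True
  then have "runs solve s 2 (\<lambda>s'. optimal_recoloring V E \<omega> c \<chi> S (output_coloring s'))"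
    using input_scalars(1) input_coloring is_graph is_coloring
    by (simp add: solve_def output_coloring_def optimal_recoloring_empty)
  moreover have "100 * 1 \<le> 100 * max 1 (3 ^ k * c * k\<^sup>2 + k * max_degree V E)"
    by (intro mult_le_mono2 max.cobounded1)
  then have "2 \<le> 100 * max 1 (3 ^ k * c * k\<^sup>2 + k * max_degree V E)"
    by (rule order_trans[rotated]) simp
  ultimately show ?thesis
    by (rule runs_mono)
next
  case False
  then obtain v where "v \<in> S"
    by blast
  then have pos: "1 \<le> m" "1 \<le> c"
    using is_graph is_coloring S_subset
    by (auto simp: graph_def coloring_def Suc_le_eq card_gt_0_iff dest: finite_subset)
  then have "solve_time m c (max_degree V E) \<le> 100 * (3 ^ m * c * m\<^sup>2 + m * max_degree V E)"
    by (rule solve_time_le)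
  also have "\<dots> \<le> 100 * max 1 (3 ^ k * c * k\<^sup>2 + k * max_degree V E)"
    using assms
    by (intro mult_le_mono2 max.coboundedI2 add_mono mult_le_mono power_mono power_increasing)
      simp_all
  finally show ?thesis
    by (rule runs_mono[OF runs_solve[OF pos]])
qed

theorem theorem4:
  "\<exists>(P :: com) (C :: nat).
    \<forall>(V :: nat set) (E :: nat set set) (\<omega> :: nat set \<Rightarrow> rat) (c :: nat) (\<chi> :: nat \<Rightarrow> nat)
      (S :: nat set) (k :: nat) (s :: state).
      graph V E \<longrightarrow> coloring V c \<chi> \<longrightarrow> S \<subseteq> V \<longrightarrow> card S \<le> k \<longrightarrow> encodes s V E \<omega> c \<chi> S \<longrightarrow>
      (\<exists>t s' \<chi>'. exec P s t s' \<and>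
        t \<le> C * max 1 (3 ^ k * c * k\<^sup>2 + k * max_degree V E) \<and>
        \<chi>' = output_coloring s' \<and>
        coloring V c \<chi>' \<and>
        D_flip V \<chi> \<chi>' \<subseteq> S \<and>
        (\<forall>\<chi>''. coloring V c \<chi>'' \<and> D_flip V \<chi> \<chi>'' \<subseteq> S \<longrightarrow>
          weight \<omega> (cut_edges E \<chi>'') \<le> weight \<omega> (cut_edges E \<chi>')))"
proof (rule exI[of _ solve], rule exI[of _ 100], intro allI impI)
  fix V E \<omega> c \<chi> S k s
  assume "graph V E" "coloring V c \<chi>" "S \<subseteq> V" and k: "card S \<le> k" and "encodes s V E \<omega> c \<chi> S"
  then interpret encoded_instance V E \<omega> c \<chi> S s
    by unfold_locales
  let ?T = "100 * max 1 (3 ^ k * c * k\<^sup>2 + k * max_degree V E)"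
  have "runs solve s ?T (\<lambda>s'. optimal_recoloring V E \<omega> c \<chi> S (output_coloring s'))"
    using k by (rule runs_solve_bounded)
  then show "\<exists>t s' \<chi>'. exec solve s t s' \<and> t \<le> ?T \<and> \<chi>' = output_coloring s' \<and>
        coloring V c \<chi>' \<and> D_flip V \<chi> \<chi>' \<subseteq> S \<and>
        (\<forall>\<chi>''. coloring V c \<chi>'' \<and> D_flip V \<chi> \<chi>'' \<subseteq> S \<longrightarrow>
          weight \<omega> (cut_edges E \<chi>'') \<le> weight \<omega> (cut_edges E \<chi>'))"
    by (auto simp: runs_def optimal_recoloring_def)
qed

end
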